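(* Let $1\le n\le N$. (i) If $\mathbf{X}=(X_1,\dots,X_n)$ is exchangeable and $N$-extendible, with values in $S^n$ for an arbitrary measurable space $S$, then its distribution $\mu_{\mathbf X}\in\mathcal P(S^n)$ has a representation $\mu_{\mathbf X}=\int_{\mathcal P(S)}\nu^n\,d\lambda(\nu)$ (meaning $\mu_{\mathbf X}(A)=\int\nu^n(A)\,d\lambda(\nu)$ for measurable $A\subseteq S^n$) with a signed measure $\lambda\in\mathcal M(\mathcal P(S))$ satisfying $\|\lambda\|_{\mathcal M(\mathcal P(S))}\le\kappa(n,N)$. The constant $\kappa(n,N)$ is in general best possible: there exist $S$ and such an $\mathbf X$ for which every representing $\lambda$ has $\|\lambda\|\ge\kappa(n,N)$. (ii) If furthermore $S$ is finite with $|S|=m$, then $\lambda$ can be chosen with $\|\lambda\|_{\mathcal M(\mathcal P(S))}\le\kappa(n,N;m):=\max_{\mathbf{x}\in S^N}\|\mu_{\mathbf{x}}\|_{\pi s+,\ell_1(S)}$. Moreover this constant is best possible for the given $S$ (it is the smallest $M$ such that every exchangeable $N$-extendible distribution on $S^n$ has such a representation with $\|\lambda\|\le M$). If $m\ge N$, then $\kappa(n,N;m)=\kappa(n,N)$.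
   Context: For a measurable space $S$, $\mathcal M(S)$ is the space of finite signed measures on $S$ with total variation norm, $\mathcal P(S)$ the probability measures; $\mathcal P(S)$ has the $\sigma$-field generated by $\mu\mapsto\mu(A)$, $A$ measurable, and $\mathcal M(\mathcal P(S))$ denotes finite signed measures on it; $\nu^n$ is the product measure. $(X_1,\dots,X_n)$ in $S^n$ is exchangeable if its distribution is invariant under coordinate permutations; it is $N$-extendible ($N\ge n$) if there is an exchangeable $(X_1,\dots,X_N)$ in $S^N$ whose first $n$ coordinates have the same distribution as $(X_1,\dots,X_n)$. For a finite set $S$, $\ell_1(S)$ is $\mathbb{R}^S$ with the $\ell_1$-norm, ordered coordinatewise; signed measures on $S^n$ are identified with elements of $\ell_1(S)^{\otimes n}$ via $\delta_{(s_1,\dots,s_n)}\leftrightarrow\delta_{s_1}\otimes\cdots\otimes\delta_{s_n}$, so exchangeable distributions are symmetric tensors in $\ell_1(S)^{\vee n}$. For a symmetric tensor $\mathbf{x}$, $\|\mathbf{x}\|_{\pi s+,\ell_1(S)}:=\inf\{\sum_k|a_k|\,\|x_k\|^n : \mathbf{x}=\sum_k a_k x_k^{\otimes n},\ x_k\in\ell_1(S),\ x_k\ge0\}$ (finite sums, $a_k\in\mathbb{R}$). $\chi_{n,N}$ is the distribution on $[N]^n$ ($[N]=\{1,\dots,N\}$) of $(Y_1,\dots,Y_n)$ where $(Y_1,\dots,Y_N)$ is a uniformly random permutation of $[N]$ (drawing $n$ elements without replacement), and $\kappa(n,N):=\|\chi_{n,N}\|_{\pi s+,\ell_1([N])}$.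 For finite $S$ and $\mathbf{x}=(x_1,\dots,x_N)\in S^N$, $\mu_{\mathbf x}$ is the distribution on $S^n$ of $(x_{Y_1},\dots,x_{Y_n})$, i.e. of $n$ draws without replacement from $x_1,\dots,x_N$. *)

theory Defs
  imports "HOL-Probability.Probability"
begin

abbreviation powS :: "nat \<Rightarrow> 'a measure \<Rightarrow> (nat \<Rightarrow> 'a) measure" where
  "powS n S \<equiv> PiM {..<n} (\<lambda>_. S)"

definition exchangeable :: "nat \<Rightarrow> 'a measure \<Rightarrow> (nat \<Rightarrow> 'a) measure \<Rightarrow> bool" where
  "exchangeable n S \<mu> \<longleftrightarrow>
     \<mu> \<in> space (prob_algebra (powS n S)) \<and>
     (\<forall>\<sigma>. \<sigma> permutes {..<n} \<longrightarrow> distr \<mu> (powS n S) (\<lambda>x. x \<circ> \<sigma>) = \<mu>)"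

definition extendible :: "nat \<Rightarrow> nat \<Rightarrow> 'a measure \<Rightarrow> (nat \<Rightarrow> 'a) measure \<Rightarrow> bool" where
  "extendible n N S \<mu> \<longleftrightarrow>
     (\<exists>\<mu>'. exchangeable N S \<mu>' \<and> distr \<mu>' (powS n S) (\<lambda>x. restrict x {..<n}) = \<mu>)"

text \<open>A finite signed measure on P(S) (= prob_algebra S) is represented (Jordan decomposition)
  as a difference of two finite (positive) measures alpha and beta on P(S); its value on a set A
  is measure alpha A - measure beta A.  Every finite signed measure arises this way.\<close>

definition tv_norm :: "'b measure \<Rightarrow> ('b set \<Rightarrow> real) \<Rightarrow> real" where
  "tv_norm M lam = Sup {(\<Sum>i<(k::nat). \<bar>lam (P i)\<bar>) | k P.
        (\<forall>i<k. P i \<in> sets M) \<and> disjoint_family_on P {..<k}}"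

definition signed_of :: "'b measure \<Rightarrow> 'b measure \<Rightarrow> 'b set \<Rightarrow> real" where
  "signed_of \<alpha> \<beta> A = measure \<alpha> A - measure \<beta> A"

definition is_signed_pair :: "'b measure \<Rightarrow> 'b measure \<Rightarrow> 'b measure \<Rightarrow> bool" where
  "is_signed_pair M \<alpha> \<beta> \<longleftrightarrow> finite_measure \<alpha> \<and> finite_measure \<beta> \<and>
     sets \<alpha> = sets M \<and> sets \<beta> = sets M"

definition represents :: "nat \<Rightarrow> 'a measure \<Rightarrow> (nat \<Rightarrow> 'a) measure
      \<Rightarrow> 'a measure measure \<Rightarrow> 'a measure measure \<Rightarrow> bool" where
  "represents n S \<mu> \<alpha> \<beta> \<longleftrightarrow> is_signed_pair (prob_algebra S) \<alpha> \<beta> \<and>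
     (\<forall>A \<in> sets (powS n S).
        measure \<mu> A = (\<integral>\<nu>. measure (powS n \<nu>) A \<partial>\<alpha>) - (\<integral>\<nu>. measure (powS n \<nu>) A \<partial>\<beta>))"

abbreviation lam_norm :: "'a measure \<Rightarrow> 'a measure measure \<Rightarrow> 'a measure measure \<Rightarrow> real" where
  "lam_norm S \<alpha> \<beta> \<equiv> tv_norm (prob_algebra S) (signed_of \<alpha> \<beta>)"

text \<open>A tensor in l1(S)^{\<otimes>n} is a function on S^n (coordinates indexed by {..<n});
  x^{\<otimes>n} has entry prod_{i<n} x(w i) at w.\<close>
definition pis_norm :: "'b set \<Rightarrow> nat \<Rightarrow> ((nat \<Rightarrow> 'b) \<Rightarrow> real) \<Rightarrow> real" where
  "pis_norm S n T = Inf {(\<Sum>k<(K::nat). \<bar>a k\<bar> * (\<Sum>s\<in>S. \<bar>x k s\<bar>) ^ n) | K a x.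
        (\<forall>k<K. \<forall>s\<in>S. x k s \<ge> 0) \<and>
        (\<forall>w \<in> PiE {..<n} (\<lambda>_. S). T w = (\<Sum>k<K. a k * (\<Prod>i<n. x k (w i))))}"

text \<open>chi_{n,N}: law on [N]^n of (Y_1,..,Y_n) for a uniformly random permutation
  (Y_1,..,Y_N) = (p 1, .., p N) of [N] = {1..N}; coordinate i<n corresponds to Y_{i+1}.\<close>
definition chi :: "nat \<Rightarrow> nat \<Rightarrow> (nat \<Rightarrow> nat) \<Rightarrow> real" where
  "chi n N w = real (card {p. p permutes {1..N} \<and> (\<forall>i<n. p (i+1) = w i)}) / fact N"

definition kappa :: "nat \<Rightarrow> nat \<Rightarrow> real" where
  "kappa n N = pis_norm {1..N} n (chi n N)"

text \<open>mu_x: law on S^n of n draws without replacement from x_1..x_N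
  (x indexed by {..<N}, drawn via a uniformly random permutation p of {..<N}).\<close>
definition mu_draw :: "nat \<Rightarrow> nat \<Rightarrow> (nat \<Rightarrow> 'b) \<Rightarrow> (nat \<Rightarrow> 'b) \<Rightarrow> real" where
  "mu_draw n N x w = real (card {p. p permutes {..<N} \<and> (\<forall>i<n. x (p i) = w i)}) / fact N"

definition kappa_m :: "nat \<Rightarrow> nat \<Rightarrow> 'b set \<Rightarrow> real" where
  "kappa_m n N S = Max ((\<lambda>x. pis_norm S n (mu_draw n N x)) ` PiE {..<N} (\<lambda>_. S))"

end

theory Submission
  imports Defs
begin

text \<open>A representation of a tensor on \<open>J\<^sup>n\<close> as a finite sum of terms \<open>a\<^sub>k x\<^sub>k\<^sup>\<otimes>\<^sup>n\<close> with
  probability vectors \<open>x\<^sub>k\<close> turns, for random \<open>X\<^sub>j\<close>, into a signed mixture of the laws of the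
  random measures \<open>\<Sum>\<^sub>j x\<^sub>k(j) \<delta>(X\<^sub>j)\<close>.  For (i) this is applied to the
  law of drawing without replacement and the extending exchangeable vector, whose average over all
  index permutations is the given law; for (ii) to the tensor of the law itself, which is a convex
  combination of the \<open>\<mu>\<^sub>x\<close>.

  Both the attainment of the infimum in the norm and the sharpness rest on one closedness property:
  by Caratheodory's theorem the number of summands can be bounded by \<open>|J|\<^sup>n\<close>, so by
  compactness tensors of cost at most \<open>M\<close> form a closed set.  An integral representation of total
  variation \<open>M\<close> is a limit of finite sums of cost at most \<open>M\<close>, obtained by rounding
  the representing measures.\<close>

subsection \<open>Tensors of bounded cost\<close>

text \<open>\<open>pis_norm\<close> is an infimum over a set that might be empty, and the infimum of
  an empty set says nothing. The argument therefore runs on \<open>pos_rep\<close>, membership in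
  the upward closure of that set, and the existence of some decomposition of the draw tensor is
  proved separately, by inclusion-exclusion over subsets. Attainment is needed because the theorem
  asserts a bound by the constant itself, without an epsilon. Bounded cost alone gives no
  compactness: along a minimising sequence the number of summands could grow without limit, and the
  vectors could be rescaled against their coefficients. Bounding the length and normalising the
  vectors removes both obstacles. In (i) the decomposition lives on the N indices and not on S, so
  it is finite for arbitrary S, and its signed coefficients do not depend on the random outcome. The
  constant of (ii) comes from decomposing on S itself, where coincidences among the drawn points can
  lower the cost.\<close>

definition pos_rep :: "'b set \<Rightarrow> nat \<Rightarrow> ((nat \<Rightarrow> 'b) \<Rightarrow> real) \<Rightarrow> real \<Rightarrow> bool" where
  "pos_rep S n T M \<longleftrightarrow> (\<exists>(K::nat) a x. (\<forall>k<K. \<forall>s\<in>S. x k s \<ge> 0) \<and>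
     (\<forall>w \<in> PiE {..<n} (\<lambda>_. S). T w = (\<Sum>k<K. a k * (\<Prod>i<n. x k (w i)))) \<and>
     (\<Sum>k<K. \<bar>a k\<bar> * (\<Sum>s\<in>S. \<bar>x k s\<bar>) ^ n) \<le> M)"

text \<open>Summands arise indexed by pairs, by subsets and by grid functions; enumerating the index
  set brings them to the form required by the definition. Nonnegativity makes the absolute values of
  the entries disappear.\<close>

lemma pos_repI:
  fixes a :: "'i \<Rightarrow> real"
  assumes "finite I"
    and "\<And>k s. k \<in> I \<Longrightarrow> s \<in> S \<Longrightarrow> x k s \<ge> 0"
    and "\<And>w. w \<in> PiE {..<n} (\<lambda>_. S) \<Longrightarrow> T w = (\<Sum>k\<in>I. a k * (\<Prod>i<n. x k (w i)))"
    and "(\<Sum>k\<in>I. \<bar>a k\<bar> * (\<Sum>s\<in>S. x k s) ^ n) \<le> M"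
  shows "pos_rep S n T M"
proof -
  obtain h where h: "bij_betw h {..<card I} I"
    using ex_bij_betw_nat_finite[OF assms(1)] by (auto simp: atLeast0LessThan)
  have hI: "h k \<in> I" if "k < card I" for k using bij_betwE[OF h] that by auto
  show ?thesis unfolding pos_rep_def
  proof (intro exI[of _ "card I"] exI[of _ "a \<circ> h"] exI[of _ "x \<circ> h"] conjI ballI)
    show "\<forall>k<card I. \<forall>s\<in>S. 0 \<le> (x \<circ> h) k s" using hI assms(2) by auto
    show "T w = (\<Sum>k<card I. (a \<circ> h) k * (\<Prod>i<n. (x \<circ> h) k (w i)))"
      if "w \<in> PiE {..<n} (\<lambda>_. S)" for w
      using sum.reindex_bij_betw[OF h, of "\<lambda>k. a k * (\<Prod>i<n. x k (w i))"] assms(3)[OF that] by simp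
    have "(\<Sum>k<card I. \<bar>(a \<circ> h) k\<bar> * (\<Sum>s\<in>S. \<bar>(x \<circ> h) k s\<bar>) ^ n)
        = (\<Sum>k\<in>I. \<bar>a k\<bar> * (\<Sum>s\<in>S. \<bar>x k s\<bar>) ^ n)"
      using sum.reindex_bij_betw[OF h, of "\<lambda>k. \<bar>a k\<bar> * (\<Sum>s\<in>S. \<bar>x k s\<bar>) ^ n"] by simp
    also have "\<dots> = (\<Sum>k\<in>I. \<bar>a k\<bar> * (\<Sum>s\<in>S. x k s) ^ n)"
      using assms(2) by (intro sum.cong refl) simp
    finally show "(\<Sum>k<card I. \<bar>(a \<circ> h) k\<bar> * (\<Sum>s\<in>S. \<bar>(x \<circ> h) k s\<bar>) ^ n) \<le> M"
      using assms(4) by simp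
  qed
qed

lemma pos_repD:
  assumes "pos_rep S n T M"
  shows "\<exists>(K::nat) a x. (\<forall>k<K. \<forall>s\<in>S. x k s \<ge> 0) \<and>
     (\<forall>w \<in> PiE {..<n} (\<lambda>_. S). T w = (\<Sum>k<K. a k * (\<Prod>i<n. x k (w i)))) \<and>
     (\<Sum>k<K. \<bar>a k\<bar> * (\<Sum>s\<in>S. x k s) ^ n) \<le> M"
proof -
  from assms obtain K :: nat and a x where
    *: "\<forall>k<K. \<forall>s\<in>S. x k s \<ge> 0"
    "\<forall>w \<in> PiE {..<n} (\<lambda>_. S). T w = (\<Sum>k<K. a k * (\<Prod>i<n. x k (w i)))"
    "(\<Sum>k<K. \<bar>a k\<bar> * (\<Sum>s\<in>S. \<bar>x k s\<bar>) ^ n) \<le> M"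
    unfolding pos_rep_def by blast
  have "(\<Sum>k<K. \<bar>a k\<bar> * (\<Sum>s\<in>S. x k s) ^ n) = (\<Sum>k<K. \<bar>a k\<bar> * (\<Sum>s\<in>S. \<bar>x k s\<bar>) ^ n)"
    using *(1) by (intro sum.cong refl) simp
  with *(3) have "(\<Sum>k<K. \<bar>a k\<bar> * (\<Sum>s\<in>S. x k s) ^ n) \<le> M" by (rule ord_eq_le_trans[rotated])
  with *(1,2) show ?thesis by blast
qed

lemma pos_rep_mono: "pos_rep S n T M \<Longrightarrow> M \<le> M' \<Longrightarrow> pos_rep S n T M'"
  unfolding pos_rep_def by (meson order_trans)

lemma pos_rep_cong:
  assumes "pos_rep S n T M" "\<And>w. w \<in> PiE {..<n} (\<lambda>_. S) \<Longrightarrow> T' w = T w"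
  shows "pos_rep S n T' M"
  using assms unfolding pos_rep_def by auto

lemma pos_rep_sum:
  assumes "finite J" "\<And>j. j \<in> J \<Longrightarrow> pos_rep S n (T j) (M j)"
  shows "pos_rep S n (\<lambda>w. \<Sum>j\<in>J. c j * T j w) (\<Sum>j\<in>J. \<bar>c j\<bar> * M j)"
proof -
  \<comment> \<open>Length, coefficients and vectors are packed into one tuple so that a single
    choice over \<open>J\<close> provides all three.\<close>
  have "\<forall>j\<in>J. \<exists>p. case p of (K::nat, a, x) \<Rightarrow> (\<forall>k<K. \<forall>s\<in>S. x k s \<ge> 0) \<and>
     (\<forall>w \<in> PiE {..<n} (\<lambda>_. S). T j w = (\<Sum>k<K. a k * (\<Prod>i<n. x k (w i)))) \<and>
     (\<Sum>k<K. \<bar>a k\<bar> * (\<Sum>s\<in>S. x k s) ^ n) \<le> M j"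
    using pos_repD[OF assms(2)] by simp
  from bchoice[OF this] obtain p where p: "\<forall>j\<in>J. case p j of (K::nat, a, x) \<Rightarrow>
     (\<forall>k<K. \<forall>s\<in>S. x k s \<ge> 0) \<and>
     (\<forall>w \<in> PiE {..<n} (\<lambda>_. S). T j w = (\<Sum>k<K. a k * (\<Prod>i<n. x k (w i)))) \<and>
     (\<Sum>k<K. \<bar>a k\<bar> * (\<Sum>s\<in>S. x k s) ^ n) \<le> M j" ..
  define K where "K j = fst (p j)" for j
  define a where "a j = fst (snd (p j))" for j
  define x where "x j = snd (snd (p j))" for j
  have x: "\<And>j k s. j \<in> J \<Longrightarrow> k < K j \<Longrightarrow> s \<in> S \<Longrightarrow> x j k s \<ge> 0"
    and T: "\<And>j w. j \<in> J \<Longrightarrow> w \<in> PiE {..<n} (\<lambda>_. S) \<Longrightarrow>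
          T j w = (\<Sum>k<K j. a j k * (\<Prod>i<n. x j k (w i)))"
    and M: "\<And>j. j \<in> J \<Longrightarrow> (\<Sum>k<K j. \<bar>a j k\<bar> * (\<Sum>s\<in>S. x j k s) ^ n) \<le> M j"
    using p unfolding K_def a_def x_def case_prod_beta by blast+
  show ?thesis
  proof (rule pos_repI[where I="Sigma J (\<lambda>j. {..<K j})" and a="\<lambda>(j,k). c j * a j k" and x="\<lambda>(j,k). x j k"])
    show "finite (Sigma J (\<lambda>j. {..<K j}))" using assms(1) by auto
    show "(case jk of (j,k) \<Rightarrow> x j k) s \<ge> 0" if "jk \<in> Sigma J (\<lambda>j. {..<K j})" "s \<in> S" for jk s
      using that x by auto
    show "(\<Sum>j\<in>J. c j * T j w) = (\<Sum>k\<in>Sigma J (\<lambda>j. {..<K j}). (case k of (j, k) \<Rightarrow> c j * a j k) *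
            (\<Prod>i<n. (case k of (j,k) \<Rightarrow> x j k) (w i)))" if "w \<in> PiE {..<n} (\<lambda>_. S)" for w
    proof -
      have "(\<Sum>j\<in>J. c j * T j w) = (\<Sum>j\<in>J. \<Sum>k<K j. c j * a j k * (\<Prod>i<n. x j k (w i)))"
        by (intro sum.cong refl) (simp add: T that sum_distrib_left mult.assoc)
      also have "\<dots> = (\<Sum>(j,k)\<in>Sigma J (\<lambda>j. {..<K j}). c j * a j k * (\<Prod>i<n. x j k (w i)))"
        using assms(1) by (subst sum.Sigma) auto
      finally show ?thesis by (simp add: case_prod_beta)
    qed
    have "(\<Sum>k\<in>Sigma J (\<lambda>j. {..<K j}). \<bar>case k of (j, k) \<Rightarrow> c j * a j k\<bar> * (\<Sum>s\<in>S. (case k of (j,k) \<Rightarrow> x j k) s) ^ n)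
        = (\<Sum>(j,k)\<in>Sigma J (\<lambda>j. {..<K j}). \<bar>c j\<bar> * (\<bar>a j k\<bar> * (\<Sum>s\<in>S. x j k s) ^ n))"
      by (simp add: case_prod_beta abs_mult mult.assoc)
    also have "\<dots> = (\<Sum>j\<in>J. \<Sum>k<K j. \<bar>c j\<bar> * (\<bar>a j k\<bar> * (\<Sum>s\<in>S. x j k s) ^ n))"
      using assms(1) by (subst sum.Sigma) auto
    also have "\<dots> \<le> (\<Sum>j\<in>J. \<bar>c j\<bar> * M j)"
      unfolding sum_distrib_left[symmetric]
      by (intro sum_mono mult_left_mono M) auto
    finally show "(\<Sum>k\<in>Sigma J (\<lambda>j. {..<K j}). \<bar>case k of (j, k) \<Rightarrow> c j * a j k\<bar> * (\<Sum>s\<in>S. (case k of (j,k) \<Rightarrow> x j k) s) ^ n)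
       \<le> (\<Sum>j\<in>J. \<bar>c j\<bar> * M j)" .
  qed
qed

text \<open>Upward closure leaves the infimum of a nonempty set bounded below by 0 unchanged. If
  there is no decomposition, both sets are empty and the two infima agree as the same default
  value.\<close>

lemma pis_norm_eq_Inf:
  assumes "finite S"
  shows "pis_norm S n T = Inf {M. pos_rep S n T M}"
proof -
  define C where "C = {(\<Sum>k<(K::nat). \<bar>a k\<bar> * (\<Sum>s\<in>S. \<bar>x k s\<bar>) ^ n) | K a x.
        (\<forall>k<K. \<forall>s\<in>S. x k s \<ge> 0) \<and>
        (\<forall>w \<in> PiE {..<n} (\<lambda>_. S). T w = (\<Sum>k<K. a k * (\<Prod>i<n. x k (w i))))}"
  have up: "{M. pos_rep S n T M} = {M. \<exists>c\<in>C. c \<le> M}"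
    unfolding C_def pos_rep_def by blast
  have bdd: "\<forall>c\<in>C. 0 \<le> c" unfolding C_def
    by (auto intro!: sum_nonneg mult_nonneg_nonneg zero_le_power)
  have bdd': "bdd_below C" using bdd by (auto intro: bdd_belowI)
  have "Inf C = Inf {M. \<exists>c\<in>C. c \<le> M}"
  proof (cases "C = {}")
    case True then show ?thesis by (simp add: Inf_real_def)
  next
    case False
    show ?thesis
    proof (rule antisym)
      show "Inf C \<le> Inf {M. \<exists>c\<in>C. c \<le> M}"
        using False cInf_lower2[OF _ _ bdd'] by (intro cInf_greatest) auto
      show "Inf {M. \<exists>c\<in>C. c \<le> M} \<le> Inf C"
        using False bdd by (intro cInf_superset_mono) (auto intro!: bdd_belowI[of _ 0] intro: order_trans)
    qed
  qed
  then show ?thesis unfolding pis_norm_def up C_def by simp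
qed

lemma pos_rep_nonneg: "pos_rep S n T M \<Longrightarrow> 0 \<le> M"
proof -
  assume "pos_rep S n T M"
  then obtain K :: nat and a x where "(\<Sum>k<K. \<bar>a k\<bar> * (\<Sum>s\<in>S. \<bar>x k s :: real\<bar>) ^ n) \<le> M"
    unfolding pos_rep_def by blast
  moreover have "0 \<le> (\<Sum>k<K. \<bar>a k\<bar> * (\<Sum>s\<in>S. \<bar>x k s\<bar>) ^ n)"
    by (intro sum_nonneg mult_nonneg_nonneg zero_le_power) auto
  ultimately show ?thesis by linarith
qed

lemma pis_norm_le: "finite S \<Longrightarrow> pos_rep S n T M \<Longrightarrow> pis_norm S n T \<le> M"
  unfolding pis_norm_eq_Inf
  by (auto intro!: cInf_lower bdd_belowI[of _ 0] dest: pos_rep_nonneg)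

section \<open>Linear relations and Caratheodory reduction\<close>

lemma ex_linear_relation:
  fixes v :: "'i \<Rightarrow> 'd \<Rightarrow> real"
  assumes "finite D" "finite I" "card D < card I"
  shows "\<exists>c. (\<exists>k\<in>I. c k \<noteq> 0) \<and> (\<forall>d\<in>D. (\<Sum>k\<in>I. c k * v k d) = 0)"
  using assms
proof (induction D arbitrary: I v rule: finite_induct)
  case empty
  then have "I \<noteq> {}" by auto
  then show ?case by (intro exI[of _ "\<lambda>_. 1"]) auto
next
  case (insert e D)
  show ?case
  proof (cases "\<forall>k\<in>I. v k e = 0")
    case True
    from insert.IH[of I v] insert.prems insert.hyps
    obtain c where "\<exists>k\<in>I. c k \<noteq> 0" "\<forall>d\<in>D. (\<Sum>k\<in>I. c k * v k d) = 0" by auto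
    with True show ?thesis by (intro exI[of _ c]) auto
  next
    case False
    then obtain p where p: "p \<in> I" "v p e \<noteq> 0" by auto
    \<comment> \<open>One step of Gaussian elimination: subtracting a multiple of the pivot vector
      makes coordinate \<open>e\<close> vanish in every \<open>u k\<close>.\<close>
    define u where "u k d = v k d - v k e / v p e * v p d" for k d
    have "card D < card (I - {p})" using insert p by simp
    from insert.IH[of "I - {p}" u] this insert.prems
    obtain c where c: "\<exists>k\<in>I-{p}. c k \<noteq> 0" "\<forall>d\<in>D. (\<Sum>k\<in>I-{p}. c k * u k d) = 0" by auto
    \<comment> \<open>The coefficient of the pivot collects all multiples that were subtracted, so
      the relation among the \<open>u k\<close> becomes one among the \<open>v k\<close>.\<close>
    define c' where "c' k = (if k = p then - (\<Sum>j\<in>I-{p}. c j * v j e / v p e) else c k)" for k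
    have eq: "(\<Sum>k\<in>I. c' k * v k d) = (\<Sum>k\<in>I-{p}. c k * u k d)" for d
    proof -
      have "(\<Sum>k\<in>I. c' k * v k d) = c' p * v p d + (\<Sum>k\<in>I-{p}. c' k * v k d)"
        using insert.prems p by (subst sum.remove[of I p]) auto
      also have "(\<Sum>k\<in>I-{p}. c' k * v k d) = (\<Sum>k\<in>I-{p}. c k * v k d)"
        by (intro sum.cong refl) (auto simp: c'_def)
      finally show ?thesis
        by (simp add: c'_def u_def right_diff_distrib sum_subtractf sum_distrib_right mult.assoc sum_distrib_left)
    qed
    have "u k e = 0" for k using p by (simp add: u_def)
    with eq c(2) have "\<forall>d\<in>insert e D. (\<Sum>k\<in>I. c' k * v k d) = 0" by auto
    moreover have "\<exists>k\<in>I. c' k \<noteq> 0" using c(1) by (auto simp: c'_def)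
    ultimately show ?thesis by blast
  qed
qed

text \<open>Moving along a linear relation among the vectors in the direction that does not increase
  the cost, until the first coefficient vanishes.\<close>

lemma caratheodory_step:
  fixes v :: "'i \<Rightarrow> 'd \<Rightarrow> real"
  assumes "finite D" "finite I" "card D < card I"
  shows "\<exists>J b. J \<subset> I \<and> (\<forall>d\<in>D. (\<Sum>k\<in>J. b k * v k d) = (\<Sum>k\<in>I. a k * v k d))
     \<and> (\<Sum>k\<in>J. \<bar>b k\<bar>) \<le> (\<Sum>k\<in>I. \<bar>a k\<bar>)"
proof (cases "\<exists>k\<in>I. a k = 0")
  case True
  then obtain p where p: "p \<in> I" "a p = 0" by auto
  show ?thesis
    using p assms by (intro exI[of _ "I - {p}"] exI[of _ a]) (auto simp: sum.remove[of I p])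
next
  case nz: False
  obtain c0 where c0: "\<exists>k\<in>I. c0 k \<noteq> 0" "\<forall>d\<in>D. (\<Sum>k\<in>I. c0 k * v k d) = 0"
    using ex_linear_relation[OF assms, of v] by auto
  \<comment> \<open>As long as no coefficient changes sign, \<open>sg c\<close> is the slope of the
    cost along \<open>a + t * c\<close>.\<close>
  define sg where "sg c = (\<Sum>k\<in>I. sgn (a k) * c k)" for c
  \<comment> \<open>The sign is chosen so that the slope is nonpositive. In the case of slope zero
    the choice also ensures that some coefficient moves towards zero, as otherwise no coefficient
    need ever vanish.\<close>
  define c where "c = (if sg c0 < 0 \<or> (sg c0 = 0 \<and> (\<exists>k\<in>I. sgn (a k) * c0 k < 0)) then c0 else (\<lambda>k. - c0 k))"
  have c: "\<forall>d\<in>D. (\<Sum>k\<in>I. c k * v k d) = 0"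
    using c0 by (auto simp: c_def sum_negf)
  have sgc: "sg c \<le> 0" by (auto simp: c_def sg_def sum_negf)
  have ex: "\<exists>k\<in>I. sgn (a k) * c k < 0"
  proof (rule ccontr)
    assume *: "\<not> (\<exists>k\<in>I. sgn (a k) * c k < 0)"
    then have "sg c = 0" using sgc unfolding sg_def by (intro antisym sum_nonneg) auto
    then have "\<forall>k\<in>I. sgn (a k) * c k = 0"
      using * assms unfolding sg_def by (subst (asm) sum_nonneg_eq_0_iff) (auto simp: not_less)
    then have "\<forall>k\<in>I. c k = 0" using nz by (auto simp: sgn_0_0)
    then show False using c0(1) by (auto simp: c_def split: if_splits)
  qed
  \<comment> \<open>\<open>P\<close> holds the indices whose coefficients shrink in absolute value;
    \<open>t\<close> is the first time at which one of them reaches zero.\<close>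
  define P where "P = {k\<in>I. sgn (a k) * c k < 0}"
  define t where "t = Min ((\<lambda>k. \<bar>a k\<bar> / \<bar>c k\<bar>) ` P)"
  have P: "finite P" "P \<noteq> {}" using assms ex by (auto simp: P_def)
  then have "t \<in> (\<lambda>k. \<bar>a k\<bar> / \<bar>c k\<bar>) ` P" unfolding t_def by (intro Min_in) auto
  then obtain p where p: "p \<in> P" "t = \<bar>a p\<bar> / \<bar>c p\<bar>" by auto
  have t0: "0 \<le> t" using p by auto
  have tle: "t * \<bar>c k\<bar> \<le> \<bar>a k\<bar>" if "k \<in> P" for k
  proof -
    have "c k \<noteq> 0" using that by (auto simp: P_def)
    moreover have "t \<le> \<bar>a k\<bar> / \<bar>c k\<bar>" unfolding t_def using P that by (intro Min_le) auto
    ultimately show ?thesis by (simp add: field_simps)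
  qed
  define b where "b k = a k + t * c k" for k
  have bp: "b p = 0"
    using p by (auto simp: b_def P_def sgn_if abs_if split: if_splits)
  \<comment> \<open>Up to time \<open>t\<close> no coefficient has crossed zero, so absolute values
    change affinely and the cost changes by exactly \<open>t * sg c\<close>.\<close>
  have absb: "\<bar>b k\<bar> = \<bar>a k\<bar> + t * (sgn (a k) * c k)" if k: "k \<in> I" for k
  proof -
    have "0 \<le> \<bar>a k\<bar> + t * (sgn (a k) * c k)"
    proof (cases "k \<in> P")
      case True
      then have "sgn (a k) * c k = - \<bar>c k\<bar>" by (auto simp: P_def sgn_if abs_if split: if_splits)
      then show ?thesis using tle[OF True] by simp
    next
      case False
      then show ?thesis using k t0 by (auto simp: P_def not_less)
    qed
    moreover have "b k = sgn (a k) * (\<bar>a k\<bar> + t * (sgn (a k) * c k))"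
      using nz k by (auto simp: b_def sgn_if abs_if algebra_simps)
    ultimately show ?thesis using nz k by (simp add: abs_mult abs_sgn_eq)
  qed
  have sumI: "(\<Sum>k\<in>I-{p}. b k * v k d) = (\<Sum>k\<in>I. a k * v k d)" if "d \<in> D" for d
  proof -
    have "(\<Sum>k\<in>I-{p}. b k * v k d) = (\<Sum>k\<in>I. b k * v k d)"
      using p assms bp by (intro sum.mono_neutral_left) (auto simp: P_def)
    also have "\<dots> = (\<Sum>k\<in>I. a k * v k d) + t * (\<Sum>k\<in>I. c k * v k d)"
      by (simp add: b_def distrib_right sum.distrib sum_distrib_left mult.assoc)
    finally show ?thesis using c that by simp
  qed
  have "(\<Sum>k\<in>I-{p}. \<bar>b k\<bar>) = (\<Sum>k\<in>I. \<bar>b k\<bar>)"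
    using p assms bp by (intro sum.mono_neutral_left) (auto simp: P_def)
  also have "\<dots> = (\<Sum>k\<in>I. \<bar>a k\<bar>) + t * sg c"
    by (simp add: absb sum.distrib sum_distrib_left sg_def)
  also have "\<dots> \<le> (\<Sum>k\<in>I. \<bar>a k\<bar>)" using t0 sgc by (simp add: mult_nonneg_nonpos)
  finally show ?thesis
    using p sumI by (intro exI[of _ "I - {p}"] exI[of _ b]) (auto simp: P_def)
qed

text \<open>The reduction step applies as long as there are more vectors than coordinates. The bound
  is \<open>card D\<close> and not \<open>card D + 1\<close> because the cost only has to stay below
  its old value; fixing it would impose one further linear constraint.\<close>

lemma caratheodory_cost:
  fixes v :: "'i \<Rightarrow> 'd \<Rightarrow> real"
  assumes "finite D" "finite I"
  shows "\<exists>J b. J \<subseteq> I \<and> card J \<le> card D \<and> (\<forall>d\<in>D. (\<Sum>k\<in>J. b k * v k d) = (\<Sum>k\<in>I. a k * v k d))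
     \<and> (\<Sum>k\<in>J. \<bar>b k\<bar>) \<le> (\<Sum>k\<in>I. \<bar>a k\<bar>)"
  using assms(2)
proof (induction I arbitrary: a rule: finite_psubset_induct)
  case (psubset I)
  show ?case
  proof (cases "card I \<le> card D")
    case True
    then show ?thesis by blast
  next
    case False
    then obtain I' a' where 1: "I' \<subset> I" "\<forall>d\<in>D. (\<Sum>k\<in>I'. a' k * v k d) = (\<Sum>k\<in>I. a k * v k d)"
       "(\<Sum>k\<in>I'. \<bar>a' k\<bar>) \<le> (\<Sum>k\<in>I. \<bar>a k\<bar>)"
      using caratheodory_step[OF assms(1) psubset.hyps, of v a] by (auto simp: not_le)
    from psubset.IH[OF 1(1), of a'] obtain J b where 2: "J \<subseteq> I'" "card J \<le> card D"
      "\<forall>d\<in>D. (\<Sum>k\<in>J. b k * v k d) = (\<Sum>k\<in>I'. a' k * v k d)" "(\<Sum>k\<in>J. \<bar>b k\<bar>) \<le> (\<Sum>k\<in>I'. \<bar>a' k\<bar>)"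
      by blast
    show ?thesis using 1 2 by (intro exI[of _ J] exI[of _ b]) auto
  qed
qed

subsection \<open>Closedness\<close>

text \<open>Homogeneity of degree n moves the mass of each vector into its coefficient. Shortening
  the sum and padding it with zero coefficients gives exactly \<open>d\<close> summands, so all
  decompositions of cost at most \<open>M\<close> are described by the same finite list of bounded
  real parameters.\<close>

lemma pos_rep_normalized:
  assumes S: "finite S" "S \<noteq> {}" and n: "1 \<le> n" and rep: "pos_rep S n T M"
  defines "d \<equiv> card (PiE {..<n} (\<lambda>_. S))"
  shows "\<exists>a x. (\<forall>k<d. (\<forall>s\<in>S. x k s \<ge> 0) \<and> (\<Sum>s\<in>S. x k s) = 1) \<and>
     (\<forall>w \<in> PiE {..<n} (\<lambda>_. S). T w = (\<Sum>k<d. a k * (\<Prod>i<n. x k (w i)))) \<and>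
     (\<Sum>k<d. \<bar>a k\<bar>) \<le> M"
proof -
  obtain K :: nat and a x where
    x0: "\<forall>k<K. \<forall>s\<in>S. x k s \<ge> 0" and
    T: "\<forall>w \<in> PiE {..<n} (\<lambda>_. S). T w = (\<Sum>k<K. a k * (\<Prod>i<n. x k (w i)))" and
    M: "(\<Sum>k<K. \<bar>a k\<bar> * (\<Sum>s\<in>S. x k s) ^ n) \<le> M"
    using pos_repD[OF rep] by blast
  define X where "X k = (\<Sum>s\<in>S. x k s)" for k
  \<comment> \<open>The uniform vector is a default value, both for vectors of mass zero and for the
    padding; in each case its coefficient is zero.\<close>
  define u where "u = (\<lambda>_::'a. 1 / real (card S))"
  define y where "y k = (if X k = 0 then u else (\<lambda>s. x k s / X k))" for k
  have X0: "0 \<le> X k" if "k < K" for k using that x0 by (auto simp: X_def intro: sum_nonneg)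
  have u: "\<forall>s. u s \<ge> 0" "(\<Sum>s\<in>S. u s) = 1" using S by (auto simp: u_def)
  have y: "(\<forall>s\<in>S. y k s \<ge> 0) \<and> (\<Sum>s\<in>S. y k s) = 1" if "k < K" for k
    using u x0 X0 that by (auto simp: y_def sum_divide_distrib[symmetric] X_def)
  \<comment> \<open>For mass zero both sides vanish: the product has at least one factor, and
    \<open>0 ^ n = 0\<close>, because \<open>1 \<le> n\<close>.\<close>
  have aX: "a k * (\<Prod>i<n. x k (w i)) = a k * X k ^ n * (\<Prod>i<n. y k (w i))"
    if w: "w \<in> PiE {..<n} (\<lambda>_. S)" and k: "k < K" for w k
  proof (cases "X k = 0")
    case True
    then have "\<forall>s\<in>S. x k s = 0" using x0 k S by (auto simp: X_def sum_nonneg_eq_0_iff)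
    moreover have "w 0 \<in> S" using PiE_mem[OF w, of 0] n by simp
    ultimately have "(\<Prod>i<n. x k (w i)) = 0" using n by (intro prod_zero) (auto intro!: bexI[of _ 0])
    moreover have "(0::real) ^ n = 0" using n by simp
    ultimately show ?thesis using True by (simp only: mult_zero_left mult_zero_right)
  next
    case False
    then show ?thesis by (simp add: y_def prod_dividef)
  qed
  \<comment> \<open>A tensor power is a vector indexed by words of length n, so \<open>d\<close> is
    the dimension of the space in which the reduction takes place.\<close>
  obtain J b where J: "J \<subseteq> {..<K}" "card J \<le> d" and
    b: "\<forall>w\<in>PiE {..<n} (\<lambda>_. S). (\<Sum>k\<in>J. b k * (\<Prod>i<n. y k (w i)))
       = (\<Sum>k<K. a k * X k ^ n * (\<Prod>i<n. y k (w i)))"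
     "(\<Sum>k\<in>J. \<bar>b k\<bar>) \<le> (\<Sum>k<K. \<bar>a k * X k ^ n\<bar>)"
    using caratheodory_cost[of "PiE {..<n} (\<lambda>_. S)" "{..<K}" "\<lambda>k w. \<Prod>i<n. y k (w i)" "\<lambda>k. a k * X k ^ n",
        OF finite_PiE[OF finite_lessThan S(1)] finite_lessThan]
    unfolding d_def by blast
  have finJ: "finite J" using J finite_subset by blast
  obtain h where h: "bij_betw h {..<card J} J"
    using ex_bij_betw_nat_finite[OF finJ] by (auto simp: atLeast0LessThan)
  have hJ: "h k \<in> J" "h k < K" if "k < card J" for k using bij_betwE[OF h] that J by auto
  define a' where "a' k = (if k < card J then b (h k) else 0)" for k
  define x' where "x' k = (if k < card J then y (h k) else u)" for k
  have re: "(\<Sum>k<d. if k < card J then g (h k) else 0) = (\<Sum>k\<in>J. g k)" for g :: "nat \<Rightarrow> real"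
  proof -
    have "(\<Sum>k<d. if k < card J then g (h k) else 0) = (\<Sum>k<card J. g (h k))"
      using J by (intro sum.mono_neutral_cong_right) auto
    also have "\<dots> = (\<Sum>k\<in>J. g k)" by (rule sum.reindex_bij_betw[OF h])
    finally show ?thesis .
  qed
  show ?thesis
  proof (intro exI[of _ a'] exI[of _ x'] conjI ballI)
    show "\<forall>k<d. (\<forall>s\<in>S. x' k s \<ge> 0) \<and> (\<Sum>s\<in>S. x' k s) = 1"
      using y hJ u by (auto simp: x'_def)
    have "(\<Sum>k<d. \<bar>a' k\<bar>) = (\<Sum>k<d. if k < card J then \<bar>b (h k)\<bar> else 0)"
      by (intro sum.cong) (auto simp: a'_def)
    also have "\<dots> \<le> (\<Sum>k<K. \<bar>a k * X k ^ n\<bar>)" unfolding re[of "\<lambda>k. \<bar>b k\<bar>"] by (rule b)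
    also have "\<dots> = (\<Sum>k<K. \<bar>a k\<bar> * (\<Sum>s\<in>S. x k s) ^ n)"
      using X0 by (intro sum.cong refl) (simp add: abs_mult X_def)
    finally show "(\<Sum>k<d. \<bar>a' k\<bar>) \<le> M" using M by simp
    fix w assume w: "w \<in> PiE {..<n} (\<lambda>_. S)"
    have "T w = (\<Sum>k<K. a k * (\<Prod>i<n. x k (w i)))" using T w by blast
    also have "\<dots> = (\<Sum>k<K. a k * X k ^ n * (\<Prod>i<n. y k (w i)))"
      by (intro sum.cong refl aX[OF w]) auto
    also have "\<dots> = (\<Sum>k\<in>J. b k * (\<Prod>i<n. y k (w i)))" using b w by simp
    also have "\<dots> = (\<Sum>k<d. if k < card J then b (h k) * (\<Prod>i<n. y (h k) (w i)) else 0)"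
      by (rule re[symmetric])
    also have "\<dots> = (\<Sum>k<d. a' k * (\<Prod>i<n. x' k (w i)))"
      by (intro sum.cong) (auto simp: a'_def x'_def)
    finally show "T w = (\<Sum>k<d. a' k * (\<Prod>i<n. x' k (w i)))" .
  qed
qed

lemma finite_index_convergent_subsequence:
  fixes f :: "nat \<Rightarrow> 'i \<Rightarrow> real"
  assumes "finite I" "\<And>i. i \<in> I \<Longrightarrow> bounded (range (\<lambda>j. f j i))"
  shows "\<exists>l r. strict_mono (r :: nat \<Rightarrow> nat) \<and> (\<forall>i\<in>I. (\<lambda>j. f (r j) i) \<longlonglongrightarrow> l i)"
proof -
  have "\<forall>\<delta>\<subseteq>I. \<exists>l r. strict_mono r \<and>
      (\<forall>\<epsilon>>0. eventually (\<lambda>n. \<forall>i\<in>\<delta>. dist (f (r n) i) (l i) < \<epsilon>) sequentially)"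
    using assms by (intro compact_lemma_general[of I "\<lambda>x i. x i" f "\<lambda>x. x"]) (auto simp: image_image)
  then obtain l r where "strict_mono r"
    "\<forall>\<epsilon>>0. eventually (\<lambda>n. \<forall>i\<in>I. dist (f (r n) i) (l i) < \<epsilon>) sequentially" by blast
  then show ?thesis
    by (intro exI[of _ l] exI[of _ r]) (fastforce intro!: tendstoI elim: eventually_mono)
qed

lemma pos_rep_limit:
  assumes S: "finite S" "S \<noteq> {}" and n: "1 \<le> n" and rep: "\<And>j. pos_rep S n (T j) (M j)"
    and T: "\<And>w. w \<in> PiE {..<n} (\<lambda>_. S) \<Longrightarrow> (\<lambda>j. T j w) \<longlonglongrightarrow> T' w" and M: "M \<longlonglongrightarrow> L"
  shows "pos_rep S n T' L"
proof -
  define d where "d = card (PiE {..<n} (\<lambda>_. S))"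
  have "\<forall>j. \<exists>a x. (\<forall>k<d. (\<forall>s\<in>S. x k s \<ge> 0) \<and> (\<Sum>s\<in>S. x k s) = 1) \<and>
     (\<forall>w \<in> PiE {..<n} (\<lambda>_. S). T j w = (\<Sum>k<d. a k * (\<Prod>i<n. x k (w i)))) \<and>
     (\<Sum>k<d. \<bar>a k\<bar>) \<le> M j"
    using pos_rep_normalized[OF S n rep] unfolding d_def by blast
  from choice[OF this] obtain a where "\<forall>j. \<exists>x. (\<forall>k<d. (\<forall>s\<in>S. x k s \<ge> 0) \<and> (\<Sum>s\<in>S. x k s) = 1) \<and>
     (\<forall>w \<in> PiE {..<n} (\<lambda>_. S). T j w = (\<Sum>k<d. a j k * (\<Prod>i<n. x k (w i)))) \<and>
     (\<Sum>k<d. \<bar>a j k\<bar>) \<le> M j" ..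
  from choice[OF this] obtain x where
    ax: "\<forall>j. (\<forall>k<d. (\<forall>s\<in>S. x j k s \<ge> 0) \<and> (\<Sum>s\<in>S. x j k s) = 1) \<and>
     (\<forall>w \<in> PiE {..<n} (\<lambda>_. S). T j w = (\<Sum>k<d. a j k * (\<Prod>i<n. x j k (w i)))) \<and>
     (\<Sum>k<d. \<bar>a j k\<bar>) \<le> M j" ..
  have x0: "0 \<le> x j k s" if "k < d" "s \<in> S" for j k s using ax that by blast
  have x1: "(\<Sum>s\<in>S. x j k s) = 1" if "k < d" for j k using ax that by blast
  have Tj: "T j w = (\<Sum>k<d. a j k * (\<Prod>i<n. x j k (w i)))" if "w \<in> PiE {..<n} (\<lambda>_. S)" for j w
    using ax that by blast
  have aM: "(\<Sum>k<d. \<bar>a j k\<bar>) \<le> M j" for j using ax by blast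
  \<comment> \<open>Coefficients (\<open>None\<close>) and vector entries (\<open>Some s\<close>)
    form one finite family of real sequences, so that one subsequence serves them all.\<close>
  define f where "f j = (\<lambda>(k, z). case z of None \<Rightarrow> a j k | Some s \<Rightarrow> x j k s)" for j
  define I where "I = {..<d} \<times> insert None (Some ` S)"
  \<comment> \<open>Coefficients are bounded by the convergent sequence \<open>M\<close>, vector
    entries by the total mass 1.\<close>
  have bnd: "bounded (range (\<lambda>j. f j i))" if iI: "i \<in> I" for i
  proof -
    from M have "Bseq M" by (intro convergent_imp_Bseq convergentI)
    then obtain B where B: "\<And>j. \<bar>M j\<bar> \<le> B" by (auto simp: Bseq_def)
    obtain k z where i: "i = (k, z)" "k < d" "z \<in> insert None (Some ` S)" using iI by (cases i) (auto simp: I_def)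
    have "\<bar>f j i\<bar> \<le> max B 1" for j
    proof (cases z)
      case None
      have "\<bar>a j k\<bar> \<le> (\<Sum>k<d. \<bar>a j k\<bar>)" using i by (intro member_le_sum) auto
      then show ?thesis using aM[of j] B[of j] None i by (auto simp: f_def)
    next
      case (Some s)
      then have "s \<in> S" using i by auto
      then have "x j k s \<le> (\<Sum>s\<in>S. x j k s)" using i S x0 by (intro member_le_sum) auto
      then show ?thesis using x1[of k j] x0[of k s j] Some i \<open>s \<in> S\<close> by (auto simp: f_def)
    qed
    then show ?thesis by (auto simp: bounded_iff)
  qed
  have finI: "finite I" using S by (auto simp: I_def)
  obtain l r where r: "strict_mono (r::nat\<Rightarrow>nat)" and l: "\<forall>i\<in>I. (\<lambda>j. f (r j) i) \<longlonglongrightarrow> l i"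
    using finite_index_convergent_subsequence[of I f] finI bnd by blast
  have la: "(\<lambda>j. a (r j) k) \<longlonglongrightarrow> l (k, None)" if "k < d" for k
    using bspec[OF l, of "(k, None)"] that by (simp add: f_def I_def)
  have lx: "(\<lambda>j. x (r j) k s) \<longlonglongrightarrow> l (k, Some s)" if "k < d" "s \<in> S" for k s
    using bspec[OF l, of "(k, Some s)"] that by (simp add: f_def I_def)
  show ?thesis
  proof (rule pos_repI[of "{..<d}" _ "\<lambda>k s. l (k, Some s)" _ _ "\<lambda>k. l (k, None)"])
    show "l (k, Some s) \<ge> 0" if "k \<in> {..<d}" "s \<in> S" for k s
      using lx[of k s] x0 that by (intro LIMSEQ_le_const[OF lx]) auto
    show "T' w = (\<Sum>k<d. l (k, None) * (\<Prod>i<n. l (k, Some (w i))))" if w: "w \<in> PiE {..<n} (\<lambda>_. S)" for w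
    proof (rule LIMSEQ_unique)
      show "(\<lambda>j. T (r j) w) \<longlonglongrightarrow> T' w"
        using LIMSEQ_subseq_LIMSEQ[OF T[OF w] r] by (simp add: o_def)
      show "(\<lambda>j. T (r j) w) \<longlonglongrightarrow> (\<Sum>k<d. l (k, None) * (\<Prod>i<n. l (k, Some (w i))))"
        unfolding Tj[OF w] using w by (intro tendsto_sum tendsto_mult tendsto_prod la lx) auto
    qed
    have "(\<lambda>j. \<Sum>s\<in>S. x (r j) k s) \<longlonglongrightarrow> (\<Sum>s\<in>S. l (k, Some s))" if "k < d" for k
      using that by (intro tendsto_sum lx)
    \<comment> \<open>The normalisation survives the limit, so the cost of the limit is just the sum
      of the absolute coefficients.\<close>
    then have l1: "(\<Sum>s\<in>S. l (k, Some s)) = 1" if "k < d" for k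
      using that x1 by (simp add: LIMSEQ_const_iff)
    have "(\<Sum>k<d. \<bar>l (k, None)\<bar> * (\<Sum>s\<in>S. l (k, Some s)) ^ n) = (\<Sum>k<d. \<bar>l (k, None)\<bar>)"
      using l1 by simp
    also have "\<dots> \<le> L"
    proof (rule LIMSEQ_le)
      show "(\<lambda>j. \<Sum>k<d. \<bar>a (r j) k\<bar>) \<longlonglongrightarrow> (\<Sum>k<d. \<bar>l (k, None)\<bar>)"
        by (intro tendsto_sum tendsto_rabs la) auto
      show "(\<lambda>j. M (r j)) \<longlonglongrightarrow> L"
        using LIMSEQ_subseq_LIMSEQ[OF M r] by (simp add: o_def)
    qed (use aM in auto)
    finally show "(\<Sum>k<d. \<bar>l (k, None)\<bar> * (\<Sum>s\<in>S. l (k, Some s)) ^ n) \<le> L" .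
  qed auto
qed

text \<open>The infimum is attained: closedness is applied to a constant sequence of tensors with
  bounds decreasing to the norm. The hypothesis \<open>rep\<close> keeps the infimum from being
  taken over the empty set.\<close>

lemma pos_rep_pis_norm:
  assumes S: "finite S" "S \<noteq> {}" and n: "1 \<le> n" and rep: "pos_rep S n T M"
  shows "pos_rep S n T (pis_norm S n T)"
proof -
  have "\<exists>c. pos_rep S n T c \<and> c < pis_norm S n T + e" if "0 < e" for e
  proof -
    have "Inf {M. pos_rep S n T M} < pis_norm S n T + e"
      using that pis_norm_eq_Inf[OF S(1), of n T] by simp
    then show ?thesis using rep cInf_lessD[of "{M. pos_rep S n T M}"] by blast
  qed
  then have "pos_rep S n T (pis_norm S n T + 1 / real (Suc j))" for j
    by (metis pos_rep_mono less_imp_le of_nat_0_less_iff zero_less_Suc zero_less_divide_1_iff)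
  moreover have "(\<lambda>j. pis_norm S n T + 1 / real (Suc j)) \<longlonglongrightarrow> pis_norm S n T + 0"
    by (intro tendsto_add tendsto_const LIMSEQ_Suc[OF lim_1_over_n])
  ultimately show ?thesis
    using pos_rep_limit[OF S n, of "\<lambda>_. T" "\<lambda>j. pis_norm S n T + 1 / real (Suc j)" T] by simp
qed

text \<open>The words lying over \<open>w'\<close> form a product of fibres of \<open>f\<close>, so
  the sum of products over them factors: pushing forward a tensor power gives the tensor power of
  the pushed-forward vector. Mass sent outside \<open>S'\<close> is lost, which can only lower the
  cost.\<close>

lemma pos_rep_pushforward:
  assumes S: "finite S" "finite S'" and rep: "pos_rep S n T M"
  shows "pos_rep S' n (\<lambda>w'. \<Sum>w | w \<in> PiE {..<n} (\<lambda>_. S) \<and> (\<forall>i<n. f (w i) = w' i). T w) M"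
proof -
  obtain K :: nat and a x where
    x0: "\<forall>k<K. \<forall>s\<in>S. x k s \<ge> 0" and
    T: "\<forall>w \<in> PiE {..<n} (\<lambda>_. S). T w = (\<Sum>k<K. a k * (\<Prod>i<n. x k (w i)))" and
    M: "(\<Sum>k<K. \<bar>a k\<bar> * (\<Sum>s\<in>S. x k s) ^ n) \<le> M"
    using pos_repD[OF rep] by blast
  define y where "y k s' = (\<Sum>s | s \<in> S \<and> f s = s'. x k s)" for k s'
  show ?thesis
  proof (rule pos_repI[of "{..<K}" _ y _ _ a])
    show "0 \<le> y k s" if "k \<in> {..<K}" for k s using that x0 by (auto simp: y_def intro: sum_nonneg)
    fix w'
    have P: "PiE {..<n} (\<lambda>i. {s \<in> S. f s = w' i}) = {w \<in> PiE {..<n} (\<lambda>_. S). \<forall>i<n. f (w i) = w' i}"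
      by (rule set_eqI, unfold PiE_iff mem_Collect_eq) blast
    have "(\<Prod>i<n. y k (w' i)) = (\<Sum>w | w \<in> PiE {..<n} (\<lambda>_. S) \<and> (\<forall>i<n. f (w i) = w' i). \<Prod>i<n. x k (w i))" for k
      unfolding y_def using S by (subst prod_sum_PiE) (auto simp: P)
    then show "(\<Sum>w | w \<in> PiE {..<n} (\<lambda>_. S) \<and> (\<forall>i<n. f (w i) = w' i). T w) = (\<Sum>k<K. a k * (\<Prod>i<n. y k (w' i)))"
      using T by (simp add: sum_distrib_left sum.swap[of _ "{..<K}"])
  next
    have "(\<Sum>s\<in>S'. y k s) \<le> (\<Sum>s\<in>S. x k s)" if "k < K" for k
    proof -
      have "(\<Sum>s\<in>S'. y k s) = (\<Sum>s | s \<in> S \<and> f s \<in> S'. x k s)"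
        unfolding y_def using S by (subst sum.group[of "{s\<in>S. f s \<in> S'}" S' f "x k", symmetric])
          (auto intro!: sum.cong)
      also have "\<dots> \<le> (\<Sum>s\<in>S. x k s)" using S x0 that by (intro sum_mono2) auto
      finally show ?thesis .
    qed
    moreover have "0 \<le> (\<Sum>s\<in>S'. y k s)" if "k < K" for k
      using x0 that by (auto simp: y_def intro!: sum_nonneg)
    ultimately have "(\<Sum>k<K. \<bar>a k\<bar> * (\<Sum>s\<in>S'. y k s) ^ n) \<le> (\<Sum>k<K. \<bar>a k\<bar> * (\<Sum>s\<in>S. x k s) ^ n)"
      by (intro sum_mono mult_left_mono power_mono) auto
    then show "(\<Sum>k<K. \<bar>a k\<bar> * (\<Sum>s\<in>S'. y k s) ^ n) \<le> M" using M by simp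
  qed auto
qed

text \<open>Each vector is restricted to the image of \<open>f\<close>. Injectivity ensures that no
  entry is counted twice, so the masses do not increase.\<close>

lemma pos_rep_pullback:
  assumes S: "finite S" and f: "inj_on f R" "f ` R \<subseteq> S" and rep: "pos_rep S n T M"
  shows "pos_rep R n (\<lambda>v. T (\<lambda>i\<in>{..<n}. f (v i))) M"
proof -
  obtain K :: nat and a x where
    x0: "\<forall>k<K. \<forall>s\<in>S. x k s \<ge> 0" and
    T: "\<forall>w \<in> PiE {..<n} (\<lambda>_. S). T w = (\<Sum>k<K. a k * (\<Prod>i<n. x k (w i)))" and
    M: "(\<Sum>k<K. \<bar>a k\<bar> * (\<Sum>s\<in>S. x k s) ^ n) \<le> M"
    using pos_repD[OF rep] by blast
  show ?thesis
  proof (rule pos_repI[of "{..<K}" _ "\<lambda>k r. x k (f r)" _ _ a])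
    show "0 \<le> x k (f s)" if "k \<in> {..<K}" "s \<in> R" for k s using that x0 f by auto
    show "T (\<lambda>i\<in>{..<n}. f (v i)) = (\<Sum>k<K. a k * (\<Prod>i<n. x k (f (v i))))"
      if "v \<in> PiE {..<n} (\<lambda>_. R)" for v
    proof -
      have "(\<lambda>i\<in>{..<n}. f (v i)) \<in> PiE {..<n} (\<lambda>_. S)" using that f by auto
      then show ?thesis using T by simp
    qed
    have "(\<Sum>s\<in>R. x k (f s)) \<le> (\<Sum>s\<in>S. x k s)" if "k < K" for k
    proof -
      have "(\<Sum>s\<in>R. x k (f s)) = (\<Sum>s\<in>f ` R. x k s)" using f by (simp add: sum.reindex)
      also have "\<dots> \<le> (\<Sum>s\<in>S. x k s)" using S f x0 that by (intro sum_mono2) auto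
      finally show ?thesis .
    qed
    moreover have "0 \<le> (\<Sum>s\<in>R. x k (f s))" if "k < K" for k
      using x0 that f by (auto intro!: sum_nonneg)
    ultimately have "(\<Sum>k<K. \<bar>a k\<bar> * (\<Sum>s\<in>R. x k (f s)) ^ n) \<le> (\<Sum>k<K. \<bar>a k\<bar> * (\<Sum>s\<in>S. x k s) ^ n)"
      by (intro sum_mono mult_left_mono power_mono) auto
    then show "(\<Sum>k<K. \<bar>a k\<bar> * (\<Sum>s\<in>R. x k (f s)) ^ n) \<le> M" using M by simp
  qed auto
qed

subsection \<open>Drawing without replacement\<close>

text \<open>"All letters lie in A" is the tensor power of the indicator of A. Moebius inversion over
  the subsets of \<open>B\<close> then expresses "the set of letters is exactly B" as a signed sum
  of such powers.\<close>

lemma pos_rep_range_eq: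
  assumes "finite R" "B \<subseteq> R"
  shows "\<exists>M. pos_rep R n (\<lambda>w. of_bool (w ` {..<n} = B)) M"
\<comment> \<open>The bound stays open until the last goal, which sets it to the cost of the sum
  constructed here.\<close>
proof (intro exI pos_repI)
  have finB: "finite B" using assms finite_subset by blast
  then show "finite (Pow B)" by simp
  show "(0::real) \<le> of_bool (s \<in> A)" for A :: "'a set" and s by simp
  fix w assume w: "w \<in> PiE {..<n} (\<lambda>_. R)"
  have "(of_bool (w ` {..<n} = B) :: real)
      = (\<Sum>A\<in>Pow B. (-1) ^ (card B - card A) * of_bool (w ` {..<n} \<subseteq> A))"
  proof (rule inclusion_exclusion_mobius[OF _ finB])
    fix A :: "'a set" assume A: "finite A"
    have "(\<Sum>C\<in>Pow A. of_bool (w ` {..<n} = C) :: real)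
      = (\<Sum>C\<in>Pow A. if C = w ` {..<n} then 1 else 0)"
      by (intro sum.cong) auto
    also have "\<dots> = (of_bool (w ` {..<n} \<subseteq> A) :: real)"
      using A by (subst sum.delta) auto
    finally show "of_bool (w ` {..<n} \<subseteq> A) = (\<Sum>C\<in>Pow A. of_bool (w ` {..<n} = C) :: real)" ..
  qed
  also have "\<dots> = (\<Sum>A\<in>Pow B. (-1) ^ (card B - card A) * (\<Prod>i<n. of_bool (w i \<in> A)))"
    by (intro sum.cong refl arg_cong2[of _ _ _ _ times]) (auto simp: image_subset_iff of_bool_def)
  finally show "(of_bool (w ` {..<n} = B) :: real)
      = (\<Sum>A\<in>Pow B. (-1) ^ (card B - card A) * (\<Prod>i<n. of_bool (w i \<in> A)))" .
qed (rule order_refl)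

text \<open>A word of length n is injective exactly when its set of letters has n elements, so the
  indicator is a sum over the n-element subsets of \<open>R\<close>.\<close>

lemma pos_rep_inj:
  assumes "finite R"
  shows "\<exists>M. pos_rep R n (\<lambda>w. of_bool (inj_on w {..<n})) M"
proof -
  define BB where "BB = {B. B \<subseteq> R \<and> card B = n}"
  have fin: "finite BB" unfolding BB_def using assms by (auto intro: finite_subset[of _ "Pow R"])
  have "\<forall>B\<in>BB. \<exists>M. pos_rep R n (\<lambda>w. of_bool (w ` {..<n} = B)) M"
    using pos_rep_range_eq[OF assms] by (auto simp: BB_def)
  from bchoice[OF this] obtain M where
    M: "\<forall>B\<in>BB. pos_rep R n (\<lambda>w. of_bool (w ` {..<n} = B)) (M B)" ..
  have "pos_rep R n (\<lambda>w. \<Sum>B\<in>BB. 1 * of_bool (w ` {..<n} = B)) (\<Sum>B\<in>BB. \<bar>1\<bar> * M B)"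
    using M fin by (intro pos_rep_sum) auto
  then have "pos_rep R n (\<lambda>w. of_bool (inj_on w {..<n})) (\<Sum>B\<in>BB. \<bar>1\<bar> * M B)"
  proof (rule pos_rep_cong)
    fix w assume w: "w \<in> PiE {..<n} (\<lambda>_. R)"
    have "(\<Sum>B\<in>BB. 1 * of_bool (w ` {..<n} = B) :: real) = (\<Sum>B\<in>BB. if B = w ` {..<n} then 1 else 0)"
      by (intro sum.cong) auto
    also have "\<dots> = of_bool (w ` {..<n} \<in> BB)" using fin by (subst sum.delta) auto
    also have "w ` {..<n} \<in> BB \<longleftrightarrow> inj_on w {..<n}"
      using w inj_on_iff_eq_card[of "{..<n}" w] by (auto simp: BB_def image_subset_iff PiE_iff)
    finally show "of_bool (inj_on w {..<n}) = (\<Sum>B\<in>BB. 1 * of_bool (w ` {..<n} = B) :: real)" ..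
  qed
  then show ?thesis ..
qed

lemma inj_extends_to_permutation:
  assumes "finite R" "A \<subseteq> R" "inj_on w A" "w ` A \<subseteq> R"
  shows "\<exists>q. q permutes R \<and> (\<forall>i\<in>A. q i = w i)"
proof -
  have finA: "finite A" using assms finite_subset by blast
  have "card (R - A) = card (R - w ` A)"
    using assms finA by (simp add: card_Diff_subset card_image)
  then obtain h where h: "bij_betw h (R - A) (R - w ` A)"
    using assms finite_same_card_bij[of "R - A" "R - w ` A"] by auto
  define q where "q i = (if i \<in> A then w i else if i \<in> R then h i else i)" for i
  have 1: "bij_betw q A (w ` A)"
    using assms(3) by (subst bij_betw_cong[of _ _ w]) (auto simp: q_def bij_betw_def)
  have 2: "bij_betw q (R - A) (R - w ` A)"
    using h by (subst bij_betw_cong[of _ _ h]) (auto simp: q_def)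
  have "bij_betw q (A \<union> (R - A)) (w ` A \<union> (R - w ` A))"
    by (rule bij_betw_combine[OF 1 2]) auto
  then have "bij_betw q R R" using assms by (simp add: Un_absorb1)
  then have "q permutes R" using assms by (intro bij_imp_permutes) (auto simp: q_def)
  then show ?thesis by (intro exI[of _ q]) (auto simp: q_def)
qed

text \<open>All injective words are equally likely: composing with a permutation that extends
  \<open>w\<close> turns the permutations fixing the first n indices into those starting with
  \<open>w\<close>. The common probability is written as the value at the identity word, which
  avoids computing it.\<close>

lemma mu_draw_id_inj:
  assumes "n \<le> N" "w \<in> PiE {..<n} (\<lambda>_. {..<N})"
  shows "mu_draw n N (\<lambda>i. i) w = mu_draw n N (\<lambda>i. i) (\<lambda>i. i) * of_bool (inj_on w {..<n})"
proof (cases "inj_on w {..<n}")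
  case True
  have w: "w ` {..<n} \<subseteq> {..<N}" using assms(2) by (auto simp: PiE_iff)
  obtain q where q: "q permutes {..<N}" "\<forall>i\<in>{..<n}. q i = w i"
    using inj_extends_to_permutation[OF finite_lessThan _ True w] assms(1) by auto
  have "bij_betw (\<lambda>p. q \<circ> p) {p. p permutes {..<N} \<and> (\<forall>i<n. p i = i)}
      {p. p permutes {..<N} \<and> (\<forall>i<n. p i = w i)}"
  proof (rule bij_betw_byWitness[where f'="\<lambda>p. inv q \<circ> p"])
    show "\<forall>p\<in>{p. p permutes {..<N} \<and> (\<forall>i<n. p i = i)}. inv q \<circ> (q \<circ> p) = p"
      using permutes_inverses[OF q(1)] by (auto simp: fun_eq_iff)
    show "\<forall>p\<in>{p. p permutes {..<N} \<and> (\<forall>i<n. p i = w i)}. q \<circ> (inv q \<circ> p) = p"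
      using permutes_inverses[OF q(1)] by (auto simp: fun_eq_iff)
    show "(\<circ>) q ` {p. p permutes {..<N} \<and> (\<forall>i<n. p i = i)} \<subseteq> {p. p permutes {..<N} \<and> (\<forall>i<n. p i = w i)}"
      using q permutes_compose by fastforce
    show "(\<circ>) (inv q) ` {p. p permutes {..<N} \<and> (\<forall>i<n. p i = w i)} \<subseteq> {p. p permutes {..<N} \<and> (\<forall>i<n. p i = i)}"
      using q permutes_compose[OF _ permutes_inv[OF q(1)]] permutes_inverses[OF q(1)]
      by (auto simp flip: q(2)[rule_format])
  qed
  from bij_betw_same_card[OF this] show ?thesis using True by (simp add: mu_draw_def)
next
  case False
  have no: "\<not> (p permutes {..<N} \<and> (\<forall>i<n. p i = w i))" for p
  proof
    assume p: "p permutes {..<N} \<and> (\<forall>i<n. p i = w i)"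
    then have "inj_on p {..<n}" using permutes_inj by (auto intro: inj_on_subset)
    then have "inj_on w {..<n}" using p by (auto simp: inj_on_def)
    with False show False ..
  qed
  then have "{p. p permutes {..<N} \<and> (\<forall>i<n. p i = w i)} = {}" by blast
  then have "mu_draw n N (\<lambda>i. i) w = 0" by (simp only: mu_draw_def card.empty of_nat_0 div_0)
  with False show ?thesis by simp
qed

lemma ex_pos_rep_mu_draw_id:
  assumes "n \<le> N"
  shows "\<exists>M. pos_rep {..<N} n (mu_draw n N (\<lambda>i. i)) M"
proof -
  obtain M where M: "pos_rep {..<N} n (\<lambda>w. of_bool (inj_on w {..<n})) M"
    using pos_rep_inj[of "{..<N}" n] by auto
  \<comment> \<open>Scaling by a constant is a linear combination over a one-point index
    set.\<close>
  have "pos_rep {..<N} n (\<lambda>w. \<Sum>j\<in>{()}. mu_draw n N (\<lambda>i. i) (\<lambda>i. i) * of_bool (inj_on w {..<n}))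
     (\<Sum>j\<in>{()}. \<bar>mu_draw n N (\<lambda>i. i) (\<lambda>i. i)\<bar> * M)"
    using M by (intro pos_rep_sum) auto
  then have "pos_rep {..<N} n (mu_draw n N (\<lambda>i. i)) (\<Sum>j\<in>{()}. \<bar>mu_draw n N (\<lambda>i. i) (\<lambda>i. i)\<bar> * M)"
    by (rule pos_rep_cong) (use mu_draw_id_inj[OF assms] in simp)
  then show ?thesis ..
qed

lemma mu_draw_eq_sum:
  "mu_draw n N x w = (\<Sum>p | p permutes {..<N}. of_bool (\<forall>i<n. x (p i) = w i)) / fact N"
proof -
  have "(\<Sum>p | p permutes {..<N}. of_bool (\<forall>i<n. x (p i) = w i) :: real)
     = real (card ({p. p permutes {..<N}} \<inter> {p. \<forall>i<n. x (p i) = w i}))"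
    using finite_permutations[of "{..<N}"] by (simp add: Groups_Big.sum_of_bool_eq)
  also have "{p. p permutes {..<N}} \<inter> {p. \<forall>i<n. x (p i) = w i}
      = {p. p permutes {..<N} \<and> (\<forall>i<n. x (p i) = w i)}" by auto
  finally show ?thesis by (simp add: mu_draw_def)
qed

text \<open>Drawing points is drawing indices and then applying \<open>x\<close>, so every draw
  tensor is an image of the one for distinct indices.\<close>

lemma mu_draw_pushforward:
  assumes "n \<le> N"
  shows "mu_draw n N x w = (\<Sum>v | v \<in> PiE {..<n} (\<lambda>_. {..<N}) \<and> (\<forall>i<n. x (v i) = w i).
      mu_draw n N (\<lambda>i. i) v)"
proof -
  define V where "V = {v. v \<in> PiE {..<n} (\<lambda>_. {..<N}) \<and> (\<forall>i<n. x (v i) = w i)}"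
  have finV: "finite V" unfolding V_def
    by (rule finite_subset[of _ "PiE {..<n} (\<lambda>_. {..<N})"]) (auto intro: finite_PiE)
  have *: "(of_bool (\<forall>i<n. x (p i) = w i) :: real) = (\<Sum>v\<in>V. of_bool (\<forall>i<n. p i = v i))"
    if p: "p permutes {..<N}" for p
  proof -
    \<comment> \<open>Words are extensional, so the restriction of \<open>p\<close> is the only word
      that can match \<open>p\<close>.\<close>
    have "(\<Sum>v\<in>V. of_bool (\<forall>i<n. p i = v i) :: real) = (\<Sum>v\<in>V. if v = restrict p {..<n} then 1 else 0)"
      by (intro sum.cong refl) (auto simp: V_def of_bool_def fun_eq_iff PiE_iff extensional_def)
    also have "\<dots> = of_bool (restrict p {..<n} \<in> V)" using finV by (subst sum.delta) auto
    also have "restrict p {..<n} \<in> V \<longleftrightarrow> (\<forall>i<n. x (p i) = w i)"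
      using permutes_in_image[OF p] assms by (auto simp: V_def)
    finally show ?thesis ..
  qed
  have "mu_draw n N x w = (\<Sum>p | p permutes {..<N}. \<Sum>v\<in>V. of_bool (\<forall>i<n. p i = v i)) / fact N"
    unfolding mu_draw_eq_sum using * by simp
  also have "\<dots> = (\<Sum>v\<in>V. mu_draw n N (\<lambda>i. i) v)"
    unfolding mu_draw_eq_sum by (subst sum.swap) (simp add: sum_divide_distrib)
  finally show ?thesis by (simp add: V_def)
qed

lemma mu_draw_inj:
  assumes "n \<le> N" "inj_on x {..<N}" "v \<in> PiE {..<n} (\<lambda>_. {..<N})"
  shows "mu_draw n N x (\<lambda>i\<in>{..<n}. x (v i)) = mu_draw n N (\<lambda>i. i) v"
proof -
  have "x (p i) = x (v i) \<longleftrightarrow> p i = v i" if "p permutes {..<N}" "i < n" for p i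
    using assms that permutes_in_image[OF that(1), of i] inj_on_eq_iff[OF assms(2), of "p i" "v i"]
    by (auto simp: PiE_iff)
  then have "{p. p permutes {..<N} \<and> (\<forall>i<n. x (p i) = (\<lambda>i\<in>{..<n}. x (v i)) i)}
     = {p. p permutes {..<N} \<and> (\<forall>i<n. p i = v i)}"
    by auto
  then show ?thesis by (simp add: mu_draw_def)
qed

text \<open>The labels 1..N are the points \<open>x i = Suc i\<close>; the two counts correspond
  under conjugation by the shift, which is the map \<open>F\<close> below.\<close>

lemma chi_eq_mu_draw:
  assumes "n \<le> N"
  shows "chi n N w = mu_draw n N Suc w"
proof -
  have "bij_betw Suc {..<N} {1..N}"
    by (rule bij_betw_byWitness[of _ "\<lambda>i. i - 1"]) auto
  note bij = bij_betw_permutations[OF this]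
  define F where "F \<pi> x = (if x \<in> {1..N} then Suc (\<pi> (inv_into {..<N} Suc x)) else x)" for \<pi> x
  have F: "bij_betw F {\<pi>. \<pi> permutes {..<N}} {\<pi>. \<pi> permutes {1..N}}"
    using bij unfolding F_def .
  have FS: "F p (i + 1) = Suc (p i)" if "i < n" for p i
    using that assms by (simp add: F_def)
  have "bij_betw F {\<pi>\<in>{\<pi>. \<pi> permutes {..<N}}. \<forall>i<n. Suc (\<pi> i) = w i}
     {\<pi>\<in>{\<pi>. \<pi> permutes {1..N}}. \<forall>i<n. \<pi> (i + 1) = w i}"
  proof (rule bij_betw_subset[OF F])
    show "F ` {\<pi> \<in> {\<pi>. \<pi> permutes {..<N}}. \<forall>i<n. Suc (\<pi> i) = w i} =
       {\<pi> \<in> {\<pi>. \<pi> permutes {1..N}}. \<forall>i<n. \<pi> (i + 1) = w i}"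
    proof (intro equalityI subsetI)
      fix q assume "q \<in> F ` {\<pi> \<in> {\<pi>. \<pi> permutes {..<N}}. \<forall>i<n. Suc (\<pi> i) = w i}"
      then show "q \<in> {\<pi> \<in> {\<pi>. \<pi> permutes {1..N}}. \<forall>i<n. \<pi> (i + 1) = w i}"
        using bij_betwE[OF F] FS by auto
    next
      fix q assume q: "q \<in> {\<pi> \<in> {\<pi>. \<pi> permutes {1..N}}. \<forall>i<n. \<pi> (i + 1) = w i}"
      then have "q \<in> F ` {\<pi>. \<pi> permutes {..<N}}" using F by (simp add: bij_betw_def)
      then obtain p where p: "q = F p" "p permutes {..<N}" by blast
      with q FS[of _ p] show "q \<in> F ` {\<pi> \<in> {\<pi>. \<pi> permutes {..<N}}. \<forall>i<n. Suc (\<pi> i) = w i}"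
        by auto
    qed
  qed auto
  from bij_betw_same_card[OF this] show ?thesis by (simp add: chi_def mu_draw_def)
qed

lemma kappa_eq:
  assumes "n \<le> N"
  shows "kappa n N = pis_norm {1..N} n (mu_draw n N Suc)"
  unfolding kappa_def using chi_eq_mu_draw[OF assms] by presburger

lemma pos_rep_mu_draw_of_id:
  assumes "n \<le> N" "finite S" "pos_rep {..<N} n (mu_draw n N (\<lambda>i. i)) M"
  shows "pos_rep S n (mu_draw n N x) M"
  using pos_rep_pushforward[OF _ assms(2,3), of x]
  by (rule pos_rep_cong) (simp_all add: mu_draw_pushforward[OF assms(1), of x])

lemma pos_rep_mu_draw_id_of_inj:
  assumes "n \<le> N" "finite S" "inj_on x {..<N}" "x ` {..<N} \<subseteq> S" "pos_rep S n (mu_draw n N x) M"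
  shows "pos_rep {..<N} n (mu_draw n N (\<lambda>i. i)) M"
  using pos_rep_pullback[OF assms(2-5)]
  by (rule pos_rep_cong) (simp add: mu_draw_inj[OF assms(1,3)])

text \<open>Distinct points are the most expensive case. An optimal decomposition on the labels 1..N
  is pulled back to the indices along the injective map \<open>Suc\<close> and then pushed forward
  along an arbitrary \<open>x\<close>.\<close>

lemma pos_rep_kappa:
  assumes "1 \<le> n" "n \<le> N" "finite S"
  shows "pos_rep S n (mu_draw n N x) (kappa n N)"
proof -
  obtain M where M: "pos_rep {..<N} n (mu_draw n N (\<lambda>i. i)) M"
    using ex_pos_rep_mu_draw_id[OF assms(2)] by auto
  have "pos_rep {1..N} n (mu_draw n N Suc) (kappa n N)"
    unfolding kappa_eq[OF assms(2)] using assms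
    by (intro pos_rep_pis_norm[OF _ _ _ pos_rep_mu_draw_of_id[OF assms(2) _ M]]) auto
  then have "pos_rep {..<N} n (mu_draw n N (\<lambda>i. i)) (kappa n N)"
    by (intro pos_rep_mu_draw_id_of_inj[OF assms(2), of "{1..N}" Suc]) auto
  from pos_rep_mu_draw_of_id[OF assms(2,3) this] show ?thesis .
qed

text \<open>The source of the lower bounds: any decomposition for N distinct points carries over to
  the indices and from there to the labels defining \<open>kappa\<close>.\<close>

lemma kappa_le:
  assumes "n \<le> N" "finite S" "inj_on x {..<N}" "x ` {..<N} \<subseteq> S" "pos_rep S n (mu_draw n N x) M"
  shows "kappa n N \<le> M"
  unfolding kappa_eq[OF assms(1)]
  by (rule pis_norm_le[OF _ pos_rep_mu_draw_of_id[OF assms(1) _ pos_rep_mu_draw_id_of_inj[OF assms]]]) simp_all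

lemma pos_rep_kappa_m:
  assumes "1 \<le> n" "n \<le> N" "finite S" "S \<noteq> {}" "x \<in> PiE {..<N} (\<lambda>_. S)"
  shows "pos_rep S n (mu_draw n N x) (kappa_m n N S)"
proof -
  have "pos_rep S n (mu_draw n N x) (pis_norm S n (mu_draw n N x))"
    using assms by (intro pos_rep_pis_norm[OF _ _ _ pos_rep_kappa]) auto
  moreover have "pis_norm S n (mu_draw n N x) \<le> kappa_m n N S"
    unfolding kappa_m_def using assms by (intro Max_ge) (auto intro: finite_PiE)
  ultimately show ?thesis by (rule pos_rep_mono)
qed

lemma kappa_m_le_iff:
  assumes "finite S" "S \<noteq> {}"
  shows "kappa_m n N S \<le> M \<longleftrightarrow> (\<forall>x\<in>PiE {..<N} (\<lambda>_. S). pis_norm S n (mu_draw n N x) \<le> M)"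
proof -
  have "PiE {..<N} (\<lambda>_. S) \<noteq> {}" using assms by (simp add: PiE_eq_empty_iff)
  then show ?thesis
    unfolding kappa_m_def using assms by (subst Max_le_iff) (auto intro: finite_PiE)
qed

lemma kappa_m_eq_kappa:
  assumes "1 \<le> n" "n \<le> N" "finite S" "S \<noteq> {}" "N \<le> card S"
  shows "kappa_m n N S = kappa n N"
proof (rule antisym)
  show "kappa_m n N S \<le> kappa n N"
    unfolding kappa_m_le_iff[OF assms(3,4)] by (intro ballI pis_norm_le pos_rep_kappa assms)
  obtain f where f: "bij_betw f {..<card S} S"
    using ex_bij_betw_nat_finite[OF assms(3)] by (auto simp: atLeast0LessThan)
  \<comment> \<open>With at least N points available, the first N of an enumeration form a vector of
    distinct entries, restricted so that it belongs to the set over which \<open>kappa_m\<close>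
    takes the maximum.\<close>
  define x where "x = restrict f {..<N}"
  have sub: "{..<N} \<subseteq> {..<card S}" using assms by auto
  have "inj_on f {..<N}" using bij_betw_imp_inj_on[OF f] sub by (rule inj_on_subset)
  then have inj: "inj_on x {..<N}" by (auto simp: x_def inj_on_def)
  have x: "x ` {..<N} \<subseteq> S" using bij_betwE[OF f] sub by (auto simp: x_def)
  then have "x \<in> PiE {..<N} (\<lambda>_. S)" by (auto simp: x_def)
  from kappa_le[OF assms(2,3) inj x pos_rep_kappa_m[OF assms(1-4) this]]
  show "kappa n N \<le> kappa_m n N S" .
qed

subsection \<open>From decompositions to signed mixtures\<close>

text \<open>The discrete measure with mass \<open>x j\<close> at the point \<open>X j\<close>, where
  points may coincide. As an image of a point measure it is a measure on all of \<open>S\<close>,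
  even when singletons are not measurable.\<close>

definition weighted_diracs :: "'j set \<Rightarrow> ('j \<Rightarrow> real) \<Rightarrow> ('j \<Rightarrow> 'a) \<Rightarrow> 'a measure \<Rightarrow> 'a measure" where
  "weighted_diracs J x X S = distr (point_measure J (\<lambda>j. ennreal (x j))) S X"

lemma sets_weighted_diracs [simp, measurable_cong]: "sets (weighted_diracs J x X S) = sets S"
  by (simp add: weighted_diracs_def)

lemma space_weighted_diracs [simp]: "space (weighted_diracs J x X S) = space S"
  by (simp add: weighted_diracs_def)

lemma emeasure_weighted_diracs:
  assumes "finite J" "X \<in> J \<rightarrow> space S" "A \<in> sets S"
  shows "emeasure (weighted_diracs J x X S) A = (\<Sum>j\<in>J. ennreal (x j) * indicator A (X j))"
proof -
  have "emeasure (weighted_diracs J x X S) A = (\<Sum>j\<in>X -` A \<inter> J. ennreal (x j))"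
    unfolding weighted_diracs_def using assms
    by (subst emeasure_distr) (auto simp: space_point_measure emeasure_point_measure_finite)
  also have "\<dots> = (\<Sum>j\<in>J. ennreal (x j) * indicator A (X j))"
    using assms(1) by (intro sum.mono_neutral_cong_left) (auto simp: indicator_def)
  finally show ?thesis .
qed

lemma measure_weighted_diracs:
  assumes "finite J" "X \<in> J \<rightarrow> space S" "A \<in> sets S" "\<And>j. j \<in> J \<Longrightarrow> 0 \<le> x j"
  shows "measure (weighted_diracs J x X S) A = (\<Sum>j\<in>J. x j * indicator A (X j))"
proof -
  have "emeasure (weighted_diracs J x X S) A = (\<Sum>j\<in>J. ennreal (x j * indicator A (X j)))"
    unfolding emeasure_weighted_diracs[OF assms(1-3)]
    by (intro sum.cong refl) (simp add: indicator_def)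
  also have "\<dots> = ennreal (\<Sum>j\<in>J. x j * indicator A (X j))"
    using assms(4) by (intro sum_ennreal) (auto simp: indicator_def)
  finally show ?thesis
    using assms(4) by (simp add: measure_def sum_nonneg indicator_def)
qed

lemma prob_space_weighted_diracs:
  assumes "finite J" "X \<in> J \<rightarrow> space S" "\<And>j. j \<in> J \<Longrightarrow> 0 \<le> x j" "(\<Sum>j\<in>J. x j) = 1"
  shows "prob_space (weighted_diracs J x X S)"
proof
  have "emeasure (weighted_diracs J x X S) (space S) = (\<Sum>j\<in>J. ennreal (x j) * indicator (space S) (X j))"
    by (rule emeasure_weighted_diracs[OF assms(1,2)]) auto
  also have "\<dots> = (\<Sum>j\<in>J. ennreal (x j))"
    using assms(2) by (intro sum.cong refl) (auto simp: indicator_def Pi_iff)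
  also have "\<dots> = 1" using assms by (subst sum_ennreal) auto
  finally show "emeasure (weighted_diracs J x X S) (space (weighted_diracs J x X S)) = 1" by simp
qed

text \<open>Evaluations at measurable sets generate the sigma-field on the probability measures, and
  here they are finite sums of indicators. Hence the random measure has a law, from which the mixing
  measure can be built.\<close>

lemma weighted_diracs_measurable:
  assumes "finite J" "\<And>j. j \<in> J \<Longrightarrow> X j \<in> Q \<rightarrow>\<^sub>M S" "\<And>j. j \<in> J \<Longrightarrow> 0 \<le> x j" "(\<Sum>j\<in>J. x j) = 1"
  shows "(\<lambda>\<omega>. weighted_diracs J x (\<lambda>j. X j \<omega>) S) \<in> Q \<rightarrow>\<^sub>M prob_algebra S"
proof (rule measurable_prob_algebraI)
  have X: "(\<lambda>j. X j \<omega>) \<in> J \<rightarrow> space S" if "\<omega> \<in> space Q" for \<omega>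
    using assms(2)[THEN measurable_space] that by auto
  show ps: "prob_space (weighted_diracs J x (\<lambda>j. X j \<omega>) S)" if "\<omega> \<in> space Q" for \<omega>
    using assms X[OF that] by (intro prob_space_weighted_diracs) auto
  show "(\<lambda>\<omega>. weighted_diracs J x (\<lambda>j. X j \<omega>) S) \<in> Q \<rightarrow>\<^sub>M subprob_algebra S"
  proof (rule measurable_subprob_algebra)
    fix A assume A: "A \<in> sets S"
    have "(\<lambda>\<omega>. indicator A (X j \<omega>) :: ennreal) \<in> borel_measurable Q" if "j \<in> J" for j
      using borel_measurable_indicator[OF A] assms(2)[OF that] by (rule measurable_compose[rotated])
    then have "(\<lambda>\<omega>. \<Sum>j\<in>J. ennreal (x j) * indicator A (X j \<omega>)) \<in> borel_measurable Q"
      by (intro borel_measurable_sum borel_measurable_times_ennreal) auto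
    then show "(\<lambda>\<omega>. emeasure (weighted_diracs J x (\<lambda>j. X j \<omega>) S) A) \<in> borel_measurable Q"
      by (subst measurable_cong[OF emeasure_weighted_diracs[OF assms(1) X A]])
  qed (use ps prob_space_imp_subprob_space in auto)
qed

text \<open>The bridge between tensors and measures: the weights of the n-fold product are the
  entries of the n-th tensor power of \<open>x\<close>. On rectangles this is the expansion of a
  product of sums.\<close>

lemma PiM_weighted_diracs:
  assumes "finite J" "X \<in> J \<rightarrow> space S" "\<And>j. j \<in> J \<Longrightarrow> 0 \<le> x j" "(\<Sum>j\<in>J. x j) = 1"
  shows "powS n (weighted_diracs J x X S) =
     weighted_diracs (PiE {..<n} (\<lambda>_. J)) (\<lambda>w. \<Prod>i<n. x (w i)) (\<lambda>w. \<lambda>i\<in>{..<n}. X (w i)) (powS n S)"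
    (is "_ = ?P")
proof -
  interpret prob_space "weighted_diracs J x X S" by (rule prob_space_weighted_diracs[OF assms])
  interpret product_sigma_finite "\<lambda>_::nat. weighted_diracs J x X S" ..
  have "?P = PiM {..<n} (\<lambda>_. weighted_diracs J x X S)"
  proof (rule PiM_eqI)
    show "sets ?P = sets (PiM {..<n} (\<lambda>_. weighted_diracs J x X S))"
      by (simp cong: sets_PiM_cong)
    fix A assume A: "\<And>i. i \<in> {..<n} \<Longrightarrow> A i \<in> sets (weighted_diracs J x X S)"
    have "emeasure ?P (PiE {..<n} A) = (\<Sum>w\<in>PiE {..<n} (\<lambda>_. J).
        ennreal (\<Prod>i<n. x (w i)) * indicator (PiE {..<n} A) (\<lambda>i\<in>{..<n}. X (w i)))"
      using assms A by (intro emeasure_weighted_diracs sets_PiM_I_finite finite_PiE)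
        (auto simp: space_PiM)
    also have "\<dots> = (\<Sum>w\<in>PiE {..<n} (\<lambda>_. J). \<Prod>i<n. ennreal (x (w i)) * indicator (A i) (X (w i)))"
    proof (intro sum.cong refl)
      fix w assume w: "w \<in> PiE {..<n} (\<lambda>_. J)"
      have "(\<Prod>i<n. indicator (A i) (X (w i)) :: ennreal) = indicator (PiE {..<n} A) (\<lambda>i\<in>{..<n}. X (w i))"
        by (cases "\<forall>i<n. X (w i) \<in> A i") (auto simp: indicator_def intro!: prod_zero)
      moreover have "ennreal (\<Prod>i<n. x (w i)) = (\<Prod>i<n. ennreal (x (w i)))"
        using assms(3) w by (intro prod_ennreal[symmetric]) auto
      ultimately show "ennreal (\<Prod>i<n. x (w i)) * indicator (PiE {..<n} A) (\<lambda>i\<in>{..<n}. X (w i))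
          = (\<Prod>i<n. ennreal (x (w i)) * indicator (A i) (X (w i)))"
        by (simp add: prod.distrib)
    qed
    also have "\<dots> = (\<Prod>i<n. \<Sum>j\<in>J. ennreal (x j) * indicator (A i) (X j))"
      using assms(1) by (subst prod_sum_PiE) auto
    also have "\<dots> = (\<Prod>i\<in>{..<n}. emeasure (weighted_diracs J x X S) (A i))"
      using assms A by (intro prod.cong refl emeasure_weighted_diracs[symmetric]) auto
    finally show "emeasure ?P (PiE {..<n} A) = (\<Prod>i\<in>{..<n}. emeasure (weighted_diracs J x X S) (A i))" .
  qed simp
  then show ?thesis ..
qed

text \<open>This gives the mixture integrals their meaning. Measurability is checked on rectangles,
  an intersection-stable generator on which the product measure is a finite product of
  evaluations.\<close>

lemma powS_measurable: "(\<lambda>\<nu>. powS n \<nu>) \<in> prob_algebra S \<rightarrow>\<^sub>M prob_algebra (powS n S)"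
proof (rule measurable_prob_algebra_generated[OF sets_PiM Int_stable_prod_algebra prod_algebra_sets_into_space])
  fix \<nu> assume \<nu>: "\<nu> \<in> space (prob_algebra S)"
  then show "prob_space (powS n \<nu>)" by (intro prob_space_PiM) (auto simp: space_prob_algebra)
  show "sets (powS n \<nu>) = sets (powS n S)"
    using \<nu> by (intro sets_PiM_cong) (auto simp: space_prob_algebra)
next
  fix A assume "A \<in> prod_algebra {..<n} (\<lambda>_. S)"
  then obtain F where A: "A = PiE {..<n} F" and F: "\<And>i. i < n \<Longrightarrow> F i \<in> sets S"
    by (auto simp: prod_algebra_eq_finite)
  have "emeasure (powS n \<nu>) A = (\<Prod>i<n. emeasure \<nu> (F i))" if \<nu>: "\<nu> \<in> space (prob_algebra S)" for \<nu>
  proof -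
    interpret prob_space \<nu> using \<nu> by (simp add: space_prob_algebra)
    interpret product_sigma_finite "\<lambda>_::nat. \<nu>" ..
    show ?thesis unfolding A using \<nu> F by (intro emeasure_PiM) (auto simp: space_prob_algebra)
  qed
  moreover have "(\<lambda>\<nu>. \<Prod>i<n. emeasure \<nu> (F i)) \<in> borel_measurable (prob_algebra S)"
    using F unfolding prob_algebra_def
    by (intro borel_measurable_prod_ennreal measurable_restrict_space1 measurable_emeasure_subprob_algebra) auto
  ultimately show "(\<lambda>\<nu>. emeasure (powS n \<nu>) A) \<in> borel_measurable (prob_algebra S)"
    by (subst measurable_cong)
qed

lemma measure_powS_measurable:
  "A \<in> sets (powS n S) \<Longrightarrow> (\<lambda>\<nu>. measure (powS n \<nu>) A) \<in> borel_measurable (prob_algebra S)"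
  by (rule measurable_compose[OF powS_measurable measurable_measure_prob_algebra])

section \<open>Total variation of a difference of finite measures\<close>

lemma sum_abs_signed_of_le:
  assumes "is_signed_pair M \<alpha> \<beta>" "finite I" "\<And>i. i \<in> I \<Longrightarrow> P i \<in> sets M" "disjoint_family_on P I"
  shows "(\<Sum>i\<in>I. \<bar>signed_of \<alpha> \<beta> (P i)\<bar>) \<le> measure \<alpha> (space M) + measure \<beta> (space M)"
proof -
  interpret a: finite_measure \<alpha> using assms by (simp add: is_signed_pair_def)
  interpret b: finite_measure \<beta> using assms by (simp add: is_signed_pair_def)
  have sets: "sets \<alpha> = sets M" "sets \<beta> = sets M" using assms by (auto simp: is_signed_pair_def)
  have "(\<Sum>i\<in>I. \<bar>signed_of \<alpha> \<beta> (P i)\<bar>) \<le> (\<Sum>i\<in>I. measure \<alpha> (P i) + measure \<beta> (P i))"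
    by (intro sum_mono) (auto simp: signed_of_def abs_le_iff)
  also have "\<dots> = measure \<alpha> (\<Union>i\<in>I. P i) + measure \<beta> (\<Union>i\<in>I. P i)"
  proof -
    have "P ` I \<subseteq> sets \<alpha>" "P ` I \<subseteq> sets \<beta>" using assms(3) sets by auto
    then show ?thesis
      using assms(2,4) by (simp add: a.finite_measure_finite_Union b.finite_measure_finite_Union sum.distrib)
  qed
  also have "\<dots> \<le> measure \<alpha> (space M) + measure \<beta> (space M)"
    using sets[THEN sets_eq_imp_space_eq] a.bounded_measure b.bounded_measure by (metis add_mono)
  finally show ?thesis .
qed

lemma tv_norm_signed_of_le:
  assumes "is_signed_pair M \<alpha> \<beta>"
  shows "tv_norm M (signed_of \<alpha> \<beta>) \<le> measure \<alpha> (space M) + measure \<beta> (space M)"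
  unfolding tv_norm_def
proof (rule cSup_least)
  show "{\<Sum>i<k. \<bar>signed_of \<alpha> \<beta> (P i)\<bar> |(k::nat) P. (\<forall>i<k. P i \<in> sets M) \<and> disjoint_family_on P {..<k}} \<noteq> {}"
    by (auto intro!: exI[of _ "0::nat"] simp: disjoint_family_on_def)
qed (auto intro!: sum_abs_signed_of_le[OF assms])

lemma sum_abs_signed_of_le_tv_norm:
  assumes "is_signed_pair M \<alpha> \<beta>" "finite I" "\<And>i. i \<in> I \<Longrightarrow> P i \<in> sets M" "disjoint_family_on P I"
  shows "(\<Sum>i\<in>I. \<bar>signed_of \<alpha> \<beta> (P i)\<bar>) \<le> tv_norm M (signed_of \<alpha> \<beta>)"
proof -
  obtain h where h: "bij_betw h {..<card I} I"
    using ex_bij_betw_nat_finite[OF assms(2)] by (auto simp: atLeast0LessThan)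
  have "(\<Sum>i\<in>I. \<bar>signed_of \<alpha> \<beta> (P i)\<bar>) = (\<Sum>k<card I. \<bar>signed_of \<alpha> \<beta> ((P \<circ> h) k)\<bar>)"
    using sum.reindex_bij_betw[OF h, of "\<lambda>i. \<bar>signed_of \<alpha> \<beta> (P i)\<bar>"] by simp
  moreover have "\<forall>k<card I. (P \<circ> h) k \<in> sets M" using bij_betwE[OF h] assms(3) by auto
  moreover have "disjoint_family_on (P \<circ> h) {..<card I}"
    unfolding disjoint_family_on_def
  proof (intro ballI impI)
    fix i j assume "i \<in> {..<card I}" "j \<in> {..<card I}" "i \<noteq> j"
    then show "(P \<circ> h) i \<inter> (P \<circ> h) j = {}"
      using assms(4) bij_betwE[OF h] inj_onD[OF bij_betw_imp_inj_on[OF h], of i j]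
      by (auto simp: disjoint_family_on_def)
  qed
  ultimately have "(\<Sum>i\<in>I. \<bar>signed_of \<alpha> \<beta> (P i)\<bar>) \<in> {\<Sum>i<k. \<bar>signed_of \<alpha> \<beta> (P i)\<bar> |(k::nat) P.
      (\<forall>i<k. P i \<in> sets M) \<and> disjoint_family_on P {..<k}}"
    by blast
  then show ?thesis unfolding tv_norm_def
    by (rule cSup_upper) (auto intro!: bdd_aboveI sum_abs_signed_of_le[OF assms(1)])
qed

text \<open>The measure is the sum of the laws of the \<open>\<nu> k\<close> with weights
  \<open>c k\<close>. It is realised as one image measure on the product of the index set with
  \<open>Q\<close>, so that integrals follow from Fubini and a change of variables.\<close>

lemma mixture_of_kernels:
  fixes c :: "nat \<Rightarrow> real"
  assumes Q: "prob_space Q" and c: "\<And>k. k < K \<Longrightarrow> 0 \<le> c k"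
    and \<nu>: "\<And>k. k < K \<Longrightarrow> \<nu> k \<in> Q \<rightarrow>\<^sub>M M"
  shows "\<exists>\<alpha>. finite_measure \<alpha> \<and> sets \<alpha> = sets M \<and> measure \<alpha> (space M) = (\<Sum>k<K. c k) \<and>
    (\<forall>g. g \<in> borel_measurable M \<longrightarrow> (\<forall>y. \<bar>g y\<bar> \<le> (1::real)) \<longrightarrow>
       (\<integral>y. g y \<partial>\<alpha>) = (\<Sum>k<K. c k * (\<integral>\<omega>. g (\<nu> k \<omega>) \<partial>Q)))"
proof -
  interpret Q: prob_space Q by fact
  interpret C: finite_measure "count_space {..<K}" by (rule finite_measure_count_space) simp
  define P where "P = count_space {..<K} \<Otimes>\<^sub>M Q"
  interpret P: pair_sigma_finite "count_space {..<K}" Q ..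
  have finP: "finite_measure P"
    unfolding P_def by (rule finite_measure_pair_measure) unfold_locales
  interpret finP: finite_measure P by (rule finP)
  define f where "f p = \<nu> (fst p) (snd p)" for p
  define d where "d p = c (fst p)" for p :: "nat \<times> 'a"
  have f: "f \<in> P \<rightarrow>\<^sub>M M" unfolding P_def f_def
    by (rule measurable_pair_measure_countable1) (use \<nu> in auto)
  have d: "d \<in> borel_measurable P" unfolding P_def d_def
    by (rule measurable_pair_measure_countable1) auto
  have d0: "0 \<le> d p" if "p \<in> space P" for p
    using that c by (auto simp: P_def d_def space_pair_measure)
  have dle: "\<bar>d p\<bar> \<le> (\<Sum>k<K. c k)" if "p \<in> space P" for p
    using that c d0[OF that] by (auto simp: P_def d_def space_pair_measure intro: member_le_sum)
  define \<alpha> where "\<alpha> = distr (density P (\<lambda>p. ennreal (d p))) M f"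
  have int: "(\<integral>y. g y \<partial>\<alpha>) = (\<Sum>k<K. c k * (\<integral>\<omega>. g (\<nu> k \<omega>) \<partial>Q))"
    if g: "g \<in> borel_measurable M" and B: "\<forall>y. \<bar>g y\<bar> \<le> (1::real)" for g
  proof -
    have gf: "(\<lambda>p. g (f p)) \<in> borel_measurable P" by (rule measurable_compose[OF f g])
    have "(\<integral>y. g y \<partial>\<alpha>) = (\<integral>p. g (f p) \<partial>density P (\<lambda>p. ennreal (d p)))"
      unfolding \<alpha>_def using f g by (intro integral_distr) auto
    also have "\<dots> = (\<integral>p. d p *\<^sub>R g (f p) \<partial>P)"
      using gf d d0 by (intro integral_density) auto
    also have "\<dots> = (\<integral>k. \<integral>\<omega>. d (k, \<omega>) *\<^sub>R g (f (k, \<omega>)) \<partial>Q \<partial>count_space {..<K})"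
    proof -
      have "integrable P (\<lambda>p. d p *\<^sub>R g (f p))"
      proof (rule finP.integrable_const_bound[where B="\<Sum>k<K. c k"])
        show "AE p in P. norm (d p *\<^sub>R g (f p)) \<le> (\<Sum>k<K. c k)"
        proof (rule AE_I2)
          fix p assume "p \<in> space P"
          have "norm (d p *\<^sub>R g (f p)) \<le> \<bar>d p\<bar> * 1"
            using B by (simp add: abs_mult mult_left_le)
          also have "\<dots> \<le> (\<Sum>k<K. c k)" using dle[OF \<open>p \<in> space P\<close>] by simp
          finally show "norm (d p *\<^sub>R g (f p)) \<le> (\<Sum>k<K. c k)" .
        qed
        show "(\<lambda>p. d p *\<^sub>R g (f p)) \<in> borel_measurable P"
          using d gf by (rule borel_measurable_scaleR)
      qed
      from P.integral_fst'[OF this[unfolded P_def]] show ?thesis by (simp add: P_def)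
    qed
    also have "\<dots> = (\<Sum>k<K. \<integral>\<omega>. d (k, \<omega>) *\<^sub>R g (f (k, \<omega>)) \<partial>Q)"
      by (rule lebesgue_integral_count_space_finite) simp
    also have "\<dots> = (\<Sum>k<K. c k * (\<integral>\<omega>. g (\<nu> k \<omega>) \<partial>Q))"
      by (simp add: d_def f_def)
    finally show ?thesis .
  qed
  have fin: "finite_measure \<alpha>"
  proof (rule finite_measureI)
    have "emeasure \<alpha> (space \<alpha>) = emeasure (density P (\<lambda>p. ennreal (d p))) (space P)"
      unfolding \<alpha>_def using f by (subst emeasure_distr) (auto intro!: arg_cong2[of _ _ _ _ emeasure] dest: measurable_space)
    also have "\<dots> = (\<integral>\<^sup>+p. ennreal (d p) \<partial>P)"
      using d by (subst emeasure_density) (auto intro!: nn_integral_cong simp: indicator_def)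
    also have "\<dots> \<le> (\<integral>\<^sup>+p. ennreal (\<Sum>k<K. c k) \<partial>P)"
      using dle by (intro nn_integral_mono ennreal_leI) (auto simp: abs_le_iff)
    also have "\<dots> < \<infinity>" by (simp add: ennreal_mult_eq_top_iff finP.emeasure_finite top.not_eq_extremum[symmetric])
    finally show "emeasure \<alpha> (space \<alpha>) \<noteq> \<infinity>" by simp
  qed
  interpret \<alpha>: finite_measure \<alpha> by (rule fin)
  have sets: "sets \<alpha> = sets M" by (simp add: \<alpha>_def)
  \<comment> \<open>The total mass is the integral formula for the constant function 1.\<close>
  have "measure \<alpha> (space M) = (\<integral>y. 1 \<partial>\<alpha>)"
    using sets_eq_imp_space_eq[OF sets] by simp
  also have "\<dots> = (\<Sum>k<K. c k)" by (subst int) (simp_all add: Q.prob_space)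
  finally show ?thesis using fin sets int by blast
qed

text \<open>Positive and negative parts of the coefficients give the two measures. These need not be
  mutually singular, but their total masses add up to the sum of the absolute coefficients, which
  bounds the variation.\<close>

lemma represents_of_kernels:
  fixes a :: "nat \<Rightarrow> real"
  assumes Q: "prob_space Q" and \<nu>: "\<And>k. k < K \<Longrightarrow> \<nu> k \<in> Q \<rightarrow>\<^sub>M prob_algebra S"
    and eq: "\<And>A. A \<in> sets (powS n S) \<Longrightarrow>
       measure \<mu> A = (\<Sum>k<K. a k * (\<integral>\<omega>. measure (powS n (\<nu> k \<omega>)) A \<partial>Q))"
  shows "\<exists>\<alpha> \<beta>. represents n S \<mu> \<alpha> \<beta> \<and> lam_norm S \<alpha> \<beta> \<le> (\<Sum>k<K. \<bar>a k\<bar>)"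
proof -
  obtain \<alpha> where \<alpha>: "finite_measure \<alpha>" "sets \<alpha> = sets (prob_algebra S)"
    "measure \<alpha> (space (prob_algebra S)) = (\<Sum>k<K. max 0 (a k))"
    "\<And>g. g \<in> borel_measurable (prob_algebra S) \<Longrightarrow> (\<forall>y. \<bar>g y\<bar> \<le> (1::real)) \<Longrightarrow>
       (\<integral>y. g y \<partial>\<alpha>) = (\<Sum>k<K. max 0 (a k) * (\<integral>\<omega>. g (\<nu> k \<omega>) \<partial>Q))"
    using mixture_of_kernels[OF Q, of K "\<lambda>k. max 0 (a k)" \<nu> "prob_algebra S"] \<nu> by auto
  obtain \<beta> where \<beta>: "finite_measure \<beta>" "sets \<beta> = sets (prob_algebra S)"
    "measure \<beta> (space (prob_algebra S)) = (\<Sum>k<K. max 0 (- a k))"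
    "\<And>g. g \<in> borel_measurable (prob_algebra S) \<Longrightarrow> (\<forall>y. \<bar>g y\<bar> \<le> (1::real)) \<Longrightarrow>
       (\<integral>y. g y \<partial>\<beta>) = (\<Sum>k<K. max 0 (- a k) * (\<integral>\<omega>. g (\<nu> k \<omega>) \<partial>Q))"
    using mixture_of_kernels[OF Q, of K "\<lambda>k. max 0 (- a k)" \<nu> "prob_algebra S"] \<nu> by auto
  have pair: "is_signed_pair (prob_algebra S) \<alpha> \<beta>" using \<alpha> \<beta> by (simp add: is_signed_pair_def)
  have "represents n S \<mu> \<alpha> \<beta>"
    unfolding represents_def
  proof (intro conjI pair ballI)
    fix A assume A: "A \<in> sets (powS n S)"
    \<comment> \<open>The integral formula is available for functions bounded by 1 everywhere, while
      \<open>measure (powS n \<nu>) A\<close> is controlled only for probability measures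
      \<open>\<nu>\<close>; truncation changes nothing on the space.\<close>
    define g where "g \<nu> = min 1 (measure (powS n \<nu>) A)" for \<nu>
    have g: "g \<in> borel_measurable (prob_algebra S)"
      using measure_powS_measurable[OF A] unfolding g_def by measurable
    have B: "\<forall>y. \<bar>g y\<bar> \<le> 1" by (auto simp: g_def min_def)
    have geq: "measure (powS n y) A = g y" if "y \<in> space (prob_algebra S)" for y
    proof -
      have "prob_space (powS n y)" using that by (intro prob_space_PiM) (auto simp: space_prob_algebra)
      then show ?thesis by (simp add: g_def prob_space.prob_le_1)
    qed
    have "(\<integral>\<nu>. measure (powS n \<nu>) A \<partial>\<alpha>) = (\<integral>\<nu>. g \<nu> \<partial>\<alpha>)"
      using geq sets_eq_imp_space_eq[OF \<alpha>(2)] by (intro Bochner_Integration.integral_cong) auto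
    moreover have "(\<integral>\<nu>. measure (powS n \<nu>) A \<partial>\<beta>) = (\<integral>\<nu>. g \<nu> \<partial>\<beta>)"
      using geq sets_eq_imp_space_eq[OF \<beta>(2)] by (intro Bochner_Integration.integral_cong) auto
    moreover have "(\<integral>\<nu>. g \<nu> \<partial>\<alpha>) - (\<integral>\<nu>. g \<nu> \<partial>\<beta>) = (\<Sum>k<K. a k * (\<integral>\<omega>. g (\<nu> k \<omega>) \<partial>Q))"
      unfolding \<alpha>(4)[OF g B] \<beta>(4)[OF g B] sum_subtractf[symmetric] left_diff_distrib[symmetric]
      by (intro sum.cong refl arg_cong2[of _ _ _ _ times]) auto
    moreover have "(\<integral>\<omega>. g (\<nu> k \<omega>) \<partial>Q) = (\<integral>\<omega>. measure (powS n (\<nu> k \<omega>)) A \<partial>Q)" if "k < K" for k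
      using geq measurable_space[OF \<nu>[OF that]] by (intro Bochner_Integration.integral_cong) auto
    ultimately show "measure \<mu> A = (\<integral>\<nu>. measure (powS n \<nu>) A \<partial>\<alpha>) - (\<integral>\<nu>. measure (powS n \<nu>) A \<partial>\<beta>)"
      using eq[OF A] by simp
  qed
  moreover have "lam_norm S \<alpha> \<beta> \<le> (\<Sum>k<K. max 0 (a k)) + (\<Sum>k<K. max 0 (- a k))"
    using tv_norm_signed_of_le[OF pair] \<alpha>(3) \<beta>(3) by simp
  moreover have "(\<Sum>k<K. max 0 (a k)) + (\<Sum>k<K. max 0 (- a k)) = (\<Sum>k<K. \<bar>a k\<bar>)"
    unfolding sum.distrib[symmetric] by (intro sum.cong) auto
  ultimately show ?thesis by auto
qed

text \<open>The k-th kernel puts mass \<open>x k j\<close> at the random point \<open>X j\<close>.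
  The expected n-th power of this measure is the average, with the entries of a tensor power as
  weights, of the laws of the words in the \<open>X j\<close>; summing over k with the signed
  coefficients recovers \<open>T\<close>, and the cost becomes the bound on the norm.\<close>

lemma represents_of_pos_rep:
  assumes Q: "prob_space Q" and J: "finite J" "J \<noteq> {}" and n: "1 \<le> n" and rep: "pos_rep J n T M"
    and X: "\<And>j. j \<in> J \<Longrightarrow> X j \<in> Q \<rightarrow>\<^sub>M S"
    and eq: "\<And>A. A \<in> sets (powS n S) \<Longrightarrow> measure \<mu> A =
       (\<Sum>w\<in>PiE {..<n} (\<lambda>_. J). T w * measure Q {\<omega> \<in> space Q. (\<lambda>i\<in>{..<n}. X (w i) \<omega>) \<in> A})"
  shows "\<exists>\<alpha> \<beta>. represents n S \<mu> \<alpha> \<beta> \<and> lam_norm S \<alpha> \<beta> \<le> M"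
proof -
  interpret prob_space Q by fact
  define W where "W = PiE {..<n} (\<lambda>_. J)"
  obtain a x where
    ax: "\<forall>k<card W. (\<forall>j\<in>J. 0 \<le> x k j) \<and> (\<Sum>j\<in>J. x k j) = 1"
    and "\<forall>w\<in>W. T w = (\<Sum>k<card W. a k * (\<Prod>i<n. x k (w i)))"
    and a: "(\<Sum>k<card W. \<bar>a k\<bar>) \<le> M"
    using pos_rep_normalized[OF J n rep] unfolding W_def by blast
  then have T: "T w = (\<Sum>k<card W. a k * (\<Prod>i<n. x k (w i)))" if "w \<in> W" for w
    using that by blast
  have x: "k < card W \<Longrightarrow> j \<in> J \<Longrightarrow> 0 \<le> x k j" "k < card W \<Longrightarrow> (\<Sum>j\<in>J. x k j) = 1" for k j
    using ax by blast+
  have finW: "finite W" unfolding W_def using J by (auto intro: finite_PiE)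
  define \<nu> where "\<nu> k \<omega> = weighted_diracs J (x k) (\<lambda>j. X j \<omega>) S" for k \<omega>
  have "\<exists>\<alpha> \<beta>. represents n S \<mu> \<alpha> \<beta> \<and> lam_norm S \<alpha> \<beta> \<le> (\<Sum>k<card W. \<bar>a k\<bar>)"
  proof (rule represents_of_kernels[OF Q, of _ \<nu>])
    show "\<nu> k \<in> Q \<rightarrow>\<^sub>M prob_algebra S" if "k < card W" for k
      unfolding \<nu>_def using that J X x by (intro weighted_diracs_measurable) auto
    fix A assume A: "A \<in> sets (powS n S)"
    define E where "E w = {\<omega> \<in> space Q. (\<lambda>i\<in>{..<n}. X (w i) \<omega>) \<in> A}" for w
    have E: "E w \<in> events" if "w \<in> W" for w
    proof -
      have "(\<lambda>\<omega>. \<lambda>i\<in>{..<n}. X (w i) \<omega>) \<in> Q \<rightarrow>\<^sub>M powS n S"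
        using that X by (intro measurable_restrict) (auto simp: W_def)
      from measurable_sets[OF this A] show ?thesis
        by (simp add: E_def vimage_def Int_def conj_commute)
    qed
    have "(\<integral>\<omega>. measure (powS n (\<nu> k \<omega>)) A \<partial>Q) = (\<Sum>w\<in>W. (\<Prod>i<n. x k (w i)) * prob (E w))"
      if k: "k < card W" for k
    proof -
      have "measure (powS n (\<nu> k \<omega>)) A = (\<Sum>w\<in>W. (\<Prod>i<n. x k (w i)) * indicator (E w) \<omega>)"
        if \<omega>: "\<omega> \<in> space Q" for \<omega>
      proof -
        have XS: "(\<lambda>j. X j \<omega>) \<in> J \<rightarrow> space S" using X[THEN measurable_space] \<omega> by auto
        have "measure (powS n (\<nu> k \<omega>)) A =
            (\<Sum>w\<in>W. (\<Prod>i<n. x k (w i)) * indicator A (\<lambda>i\<in>{..<n}. X (w i) \<omega>))"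
          unfolding \<nu>_def using k x J A XS
          by (subst PiM_weighted_diracs[OF J(1) XS])
             (auto simp: W_def space_PiM Pi_iff PiE_iff intro!: measure_weighted_diracs finite_PiE prod_nonneg)
        also have "\<dots> = (\<Sum>w\<in>W. (\<Prod>i<n. x k (w i)) * indicator (E w) \<omega>)"
          using \<omega> by (intro sum.cong refl) (auto simp: E_def indicator_def)
        finally show ?thesis .
      qed
      then have "(\<integral>\<omega>. measure (powS n (\<nu> k \<omega>)) A \<partial>Q)
          = (\<integral>\<omega>. (\<Sum>w\<in>W. (\<Prod>i<n. x k (w i)) * indicator (E w) \<omega>) \<partial>Q)"
        by (intro Bochner_Integration.integral_cong) auto
      also have "\<dots> = (\<Sum>w\<in>W. \<integral>\<omega>. (\<Prod>i<n. x k (w i)) * indicator (E w) \<omega> \<partial>Q)"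
        using E by (intro Bochner_Integration.integral_sum integrable_mult_right integrable_real_indicator)
          (auto simp: emeasure_eq_measure)
      also have "\<dots> = (\<Sum>w\<in>W. (\<Prod>i<n. x k (w i)) * prob (E w))"
        using E by (intro sum.cong refl) simp
      finally show ?thesis .
    qed
    then have "(\<Sum>k<card W. a k * (\<integral>\<omega>. measure (powS n (\<nu> k \<omega>)) A \<partial>Q))
        = (\<Sum>k<card W. \<Sum>w\<in>W. a k * (\<Prod>i<n. x k (w i)) * prob (E w))"
      by (intro sum.cong refl) (simp add: sum_distrib_left mult.assoc)
    also have "\<dots> = (\<Sum>w\<in>W. T w * prob (E w))"
      by (subst sum.swap) (auto intro!: sum.cong simp: T sum_distrib_right)
    also have "\<dots> = measure \<mu> A" using eq[OF A] by (simp add: W_def E_def)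
    finally show "measure \<mu> A = (\<Sum>k<card W. a k * (\<integral>\<omega>. measure (powS n (\<nu> k \<omega>)) A \<partial>Q))" ..
  qed
  then show ?thesis using a by (auto intro: order_trans)
qed

subsection \<open>From signed mixtures to decompositions\<close>

lemma powS_count_space:
  "finite S \<Longrightarrow> powS n (count_space S) = count_space (PiE {..<n} (\<lambda>_. S))"
  by (intro count_space_PiM_finite countable_finite) auto

lemma measure_powS_singleton:
  assumes "\<nu> \<in> space (prob_algebra (count_space S))" "w \<in> PiE {..<n} (\<lambda>_. S)"
  shows "measure (powS n \<nu>) {w} = (\<Prod>i<n. measure \<nu> {w i})"
proof -
  interpret prob_space \<nu> using assms by (simp add: space_prob_algebra)
  interpret finite_product_prob_space "\<lambda>_::nat. \<nu>" "{..<n}" by unfold_locales auto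
  have "measure (powS n \<nu>) (PiE {..<n} (\<lambda>i. {w i})) = (\<Prod>i<n. measure \<nu> {w i})"
    using assms by (intro finite_measure_PiM_emb) (auto simp: space_prob_algebra)
  moreover have "PiE {..<n} (\<lambda>i. {w i}) = {w}"
    using assms(2) by (intro PiE_singleton) (simp add: PiE_iff)
  ultimately show ?thesis by simp
qed

lemma nat_floor_div_tendsto:
  assumes "0 \<le> t"
  shows "(\<lambda>j. real (nat \<lfloor>real (Suc j) * t\<rfloor>) / real (Suc j)) \<longlonglongrightarrow> t"
proof (rule tendsto_sandwich)
  have "t - 1 / real (Suc j) \<le> real (nat \<lfloor>real (Suc j) * t\<rfloor>) / real (Suc j)" for j
  proof -
    have "real (Suc j) * t - 1 \<le> real (nat \<lfloor>real (Suc j) * t\<rfloor>)" by linarith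
    then have "(real (Suc j) * t - 1) / real (Suc j) \<le> real (nat \<lfloor>real (Suc j) * t\<rfloor>) / real (Suc j)"
      by (rule divide_right_mono) simp
    then show ?thesis by (simp add: diff_divide_distrib del: of_nat_Suc)
  qed
  then show "\<forall>\<^sub>F j in sequentially. t - 1 / real (Suc j) \<le> real (nat \<lfloor>real (Suc j) * t\<rfloor>) / real (Suc j)"
    by simp
  have "real (nat \<lfloor>real (Suc j) * t\<rfloor>) / real (Suc j) \<le> t" for j
  proof -
    have "real (nat \<lfloor>real (Suc j) * t\<rfloor>) \<le> real (Suc j) * t" using assms by simp
    then show ?thesis by (simp add: field_simps del: of_nat_Suc)
  qed
  then show "\<forall>\<^sub>F j in sequentially. real (nat \<lfloor>real (Suc j) * t\<rfloor>) / real (Suc j) \<le> t" by simp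
  show "(\<lambda>j. t - 1 / real (Suc j)) \<longlonglongrightarrow> t"
    using tendsto_diff[OF tendsto_const LIMSEQ_Suc[OF lim_1_over_n], of t] by simp
qed simp

text \<open>The masses of \<open>\<nu>\<close> are rounded down to multiples of \<open>1/(j+1)\<close>; dominated convergence
  passes to the limit.\<close>

lemma pos_rep_of_represents:
  assumes S: "finite S" "S \<noteq> {}" and n: "1 \<le> n" and rep: "represents n (count_space S) \<mu> \<alpha> \<beta>"
  shows "pos_rep S n (\<lambda>w. measure \<mu> {w}) (lam_norm (count_space S) \<alpha> \<beta>)"
proof -
  define PA where "PA = prob_algebra (count_space S)"
  have pair: "is_signed_pair PA \<alpha> \<beta>" using rep by (simp add: represents_def PA_def)
  have fin: "finite_measure \<alpha>" "finite_measure \<beta>" and sets: "sets \<alpha> = sets PA" "sets \<beta> = sets PA"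
    using pair by (auto simp: is_signed_pair_def)
  have space: "space \<alpha> = space PA" "space \<beta> = space PA"
    using sets[THEN sets_eq_imp_space_eq] by auto
  \<comment> \<open>Rounding splits the probability measures into finitely many cells
    \<open>P j c\<close>; \<open>g\<close> is an entry of the tensor power of the rounded mass
    vector and is constant on each cell.\<close>
  define r where "r j \<nu> s = nat \<lfloor>real (Suc j) * measure \<nu> {s}\<rfloor>" for j and \<nu> :: "'a measure" and s
  define C where "C j = PiE S (\<lambda>_. {..Suc j})" for j :: nat
  define P where "P j c = {\<nu> \<in> space PA. \<forall>s\<in>S. r j \<nu> s = c s}" for j c
  define g where "g w j \<nu> = (\<Prod>i<n. real (r j \<nu> (w i)) / real (Suc j))" for w j \<nu>
  have finC: "finite (C j)" for j using S by (auto simp: C_def intro: finite_PiE)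
  have meas1: "(\<lambda>\<nu>. measure \<nu> {s}) \<in> borel_measurable PA" if "s \<in> S" for s
    unfolding PA_def using that by (intro measurable_measure_prob_algebra) auto
  have measr: "(\<lambda>\<nu>. r j \<nu> s) \<in> PA \<rightarrow>\<^sub>M count_space UNIV" if "s \<in> S" for j s
    using meas1[OF that] unfolding r_def by measurable
  have P: "P j c \<in> sets PA" for j c
  proof -
    have "Measurable.pred PA (\<lambda>\<nu>. \<forall>s\<in>S. r j \<nu> s = c s)"
      using S measr by (intro pred_intros_finite) (auto intro: measurable_compose[OF measr])
    then show ?thesis unfolding P_def by (simp add: pred_def)
  qed
  have le1: "measure \<nu> {s} \<le> 1" if "\<nu> \<in> space PA" for \<nu> s
    using that by (simp add: PA_def space_prob_algebra prob_space.prob_le_1)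
  have rle: "real (r j \<nu> s) \<le> real (Suc j) * measure \<nu> {s}" for j \<nu> s
    unfolding r_def by simp
  have rle': "r j \<nu> s \<le> Suc j" if "\<nu> \<in> space PA" for j \<nu> s
  proof -
    have "real (Suc j) * measure \<nu> {s} \<le> real (Suc j) * 1"
      by (intro mult_left_mono le1 that) simp
    with rle[of j \<nu> s] have "real (r j \<nu> s) \<le> real (Suc j) * 1" by (rule order_trans)
    then show ?thesis by (simp only: mult_1_right of_nat_le_iff)
  qed
  have gsum: "g w j \<nu> = (\<Sum>c\<in>C j. (\<Prod>i<n. real (c (w i)) / real (Suc j)) * indicator (P j c) \<nu>)"
    if \<nu>: "\<nu> \<in> space PA" and w: "w \<in> PiE {..<n} (\<lambda>_. S)" for w j \<nu>
  proof -
    \<comment> \<open>The unique cell containing \<open>\<nu>\<close>; all other terms of the sum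
      vanish.\<close>
    define c0 where "c0 = restrict (r j \<nu>) S"
    have c0: "c0 \<in> C j" using rle'[OF \<nu>] by (auto simp: c0_def C_def)
    have ind: "indicator (P j c) \<nu> = (if c = c0 then 1 else 0 :: real)" if "c \<in> C j" for c
    proof -
      have "(\<forall>s\<in>S. r j \<nu> s = c s) \<longleftrightarrow> c = c0"
      proof
        assume "\<forall>s\<in>S. r j \<nu> s = c s"
        then show "c = c0"
          using that c0 unfolding C_def by (intro PiE_ext[of c S _ c0]) (simp_all add: c0_def)
      qed (simp add: c0_def)
      then show ?thesis using \<nu> by (simp add: P_def indicator_def)
    qed
    have "(\<Sum>c\<in>C j. (\<Prod>i<n. real (c (w i)) / real (Suc j)) * indicator (P j c) \<nu>)
       = (\<Sum>c\<in>C j. if c = c0 then (\<Prod>i<n. real (c (w i)) / real (Suc j)) else 0)"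
      by (intro sum.cong refl) (simp add: ind)
    also have "\<dots> = (\<Prod>i<n. real (c0 (w i)) / real (Suc j))"
      using c0 finC by (subst sum.delta) auto
    also have "\<dots> = g w j \<nu>"
      unfolding g_def using w by (intro prod.cong refl) (auto simp: c0_def)
    finally show ?thesis ..
  qed
  have int: "(\<integral>\<nu>. g w j \<nu> \<partial>\<gamma>) = (\<Sum>c\<in>C j. (\<Prod>i<n. real (c (w i)) / real (Suc j)) * measure \<gamma> (P j c))"
    if \<gamma>: "finite_measure \<gamma>" "sets \<gamma> = sets PA" and w: "w \<in> PiE {..<n} (\<lambda>_. S)" for \<gamma> w j
  proof -
    interpret finite_measure \<gamma> by fact
    have "(\<integral>\<nu>. g w j \<nu> \<partial>\<gamma>)
        = (\<integral>\<nu>. (\<Sum>c\<in>C j. (\<Prod>i<n. real (c (w i)) / real (Suc j)) * indicator (P j c) \<nu>) \<partial>\<gamma>)"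
      using gsum w sets_eq_imp_space_eq[OF \<gamma>(2)] by (intro Bochner_Integration.integral_cong) auto
    also have "\<dots> = (\<Sum>c\<in>C j. \<integral>\<nu>. (\<Prod>i<n. real (c (w i)) / real (Suc j)) * indicator (P j c) \<nu> \<partial>\<gamma>)"
      using P \<gamma> by (intro Bochner_Integration.integral_sum integrable_mult_right integrable_real_indicator)
        (auto simp: emeasure_eq_measure)
    also have "\<dots> = (\<Sum>c\<in>C j. (\<Prod>i<n. real (c (w i)) / real (Suc j)) * measure \<gamma> (P j c))"
      using P \<gamma> by (intro sum.cong refl) simp
    finally show ?thesis .
  qed
  have lim: "(\<lambda>j. \<integral>\<nu>. g w j \<nu> \<partial>\<gamma>) \<longlonglongrightarrow> (\<integral>\<nu>. measure (powS n \<nu>) {w} \<partial>\<gamma>)"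
    if \<gamma>: "finite_measure \<gamma>" "sets \<gamma> = sets PA" and w: "w \<in> PiE {..<n} (\<lambda>_. S)" for \<gamma> w
  proof -
    interpret finite_measure \<gamma> by fact
    have sp: "space \<gamma> = space PA" by (rule sets_eq_imp_space_eq[OF \<gamma>(2)])
    have wS: "w i \<in> S" if "i < n" for i using w that by auto
    show ?thesis
    proof (rule integral_dominated_convergence[where w="\<lambda>_. 1"])
      have "{w} \<in> sets (powS n (count_space S))" using w S by (simp add: powS_count_space)
      from measure_powS_measurable[OF this]
      show "(\<lambda>\<nu>. measure (powS n \<nu>) {w}) \<in> borel_measurable \<gamma>"
        unfolding measurable_cong_sets[OF \<gamma>(2) refl] PA_def .
      show "(\<lambda>\<nu>. g w j \<nu>) \<in> borel_measurable \<gamma>" for j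
        unfolding measurable_cong_sets[OF \<gamma>(2) refl] g_def
        by (intro borel_measurable_prod borel_measurable_divide measurable_compose[OF measr] wS) auto
      show "AE \<nu> in \<gamma>. (\<lambda>j. g w j \<nu>) \<longlonglongrightarrow> measure (powS n \<nu>) {w}"
      proof (rule AE_I2)
        fix \<nu> assume "\<nu> \<in> space \<gamma>"
        then have "measure (powS n \<nu>) {w} = (\<Prod>i<n. measure \<nu> {w i})"
          using sp w by (intro measure_powS_singleton) (auto simp: PA_def)
        then show "(\<lambda>j. g w j \<nu>) \<longlonglongrightarrow> measure (powS n \<nu>) {w}"
          unfolding g_def r_def by (simp only:) (intro tendsto_prod nat_floor_div_tendsto measure_nonneg)
      qed
      show "AE \<nu> in \<gamma>. norm (g w j \<nu>) \<le> 1" for j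
      proof (rule AE_I2)
        fix \<nu> assume "\<nu> \<in> space \<gamma>"
        then have "real (r j \<nu> s) / real (Suc j) \<le> 1" for s
          using rle'[of \<nu> j s] sp by (simp add: divide_le_eq del: of_nat_Suc)
        then have "g w j \<nu> \<le> 1" unfolding g_def by (intro prod_le_1) auto
        moreover have "0 \<le> g w j \<nu>" unfolding g_def by (intro prod_nonneg) auto
        ultimately show "norm (g w j \<nu>) \<le> 1" by simp
      qed
    qed simp
  qed
  define T where "T j w = (\<integral>\<nu>. g w j \<nu> \<partial>\<alpha>) - (\<integral>\<nu>. g w j \<nu> \<partial>\<beta>)" for j w
  show ?thesis
  proof (rule pos_rep_limit[OF S n, of T "\<lambda>_. lam_norm (count_space S) \<alpha> \<beta>"])
    show "pos_rep S n (T j) (lam_norm (count_space S) \<alpha> \<beta>)" for j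
    proof (rule pos_repI[OF finC[of j], of _ "\<lambda>c s. real (c s) / real (Suc j)" _ _ "\<lambda>c. signed_of \<alpha> \<beta> (P j c)"])
      show "T j w = (\<Sum>c\<in>C j. signed_of \<alpha> \<beta> (P j c) * (\<Prod>i<n. real (c (w i)) / real (Suc j)))"
        if "w \<in> PiE {..<n} (\<lambda>_. S)" for w
        unfolding T_def int[OF fin(1) sets(1) that] int[OF fin(2) sets(2) that] sum_subtractf[symmetric]
        by (intro sum.cong refl) (simp only: signed_of_def left_diff_distrib mult.commute)
      have "(\<Sum>c\<in>C j. \<bar>signed_of \<alpha> \<beta> (P j c)\<bar> * (\<Sum>s\<in>S. real (c s) / real (Suc j)) ^ n)
          \<le> (\<Sum>c\<in>C j. \<bar>signed_of \<alpha> \<beta> (P j c)\<bar>)"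
      proof (rule sum_mono)
        fix c
        show "\<bar>signed_of \<alpha> \<beta> (P j c)\<bar> * (\<Sum>s\<in>S. real (c s) / real (Suc j)) ^ n \<le> \<bar>signed_of \<alpha> \<beta> (P j c)\<bar>"
        \<comment> \<open>A grid vector may have total mass above 1, but then its cell is empty and
          its coefficient zero. In a nonempty cell, rounding down keeps the total mass at most
          1.\<close>
        proof (cases "P j c = {}")
          case True
          then show ?thesis by (simp add: signed_of_def)
        next
          case False
          then obtain \<nu> where \<nu>: "\<nu> \<in> space PA" "\<forall>s\<in>S. r j \<nu> s = c s" by (auto simp: P_def)
          interpret prob_space \<nu> using \<nu> by (simp add: PA_def space_prob_algebra)
          have sp: "space \<nu> = S" "sets \<nu> = Pow S"
            using \<nu>(1) sets_eq_imp_space_eq[of \<nu> "count_space S"] by (auto simp: PA_def space_prob_algebra)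
          have "(\<Sum>s\<in>S. real (c s) / real (Suc j)) \<le> (\<Sum>s\<in>S. measure \<nu> {s})"
          proof (rule sum_mono)
            fix s assume "s \<in> S"
            with \<nu>(2) rle[of j \<nu> s] have "real (c s) \<le> real (Suc j) * measure \<nu> {s}" by auto
            then show "real (c s) / real (Suc j) \<le> measure \<nu> {s}"
              by (simp add: divide_le_eq mult.commute del: of_nat_Suc)
          qed
          also have "\<dots> = measure \<nu> S"
            using S sp by (subst finite_measure_eq_sum_singleton) auto
          also have "\<dots> = 1" using prob_space sp by simp
          finally have "(\<Sum>s\<in>S. real (c s) / real (Suc j)) ^ n \<le> 1"
            by (intro power_le_one sum_nonneg) auto
          then show ?thesis by (intro mult_left_le) auto
        qed
      qed
      also have "\<dots> \<le> lam_norm (count_space S) \<alpha> \<beta>"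
        unfolding PA_def[symmetric]
      \<comment> \<open>The cells are finitely many disjoint measurable sets, so the remaining sum
        is one of those in the supremum defining the norm.\<close>
      proof (rule sum_abs_signed_of_le_tv_norm[OF pair finC P])
        show "disjoint_family_on (P j) (C j)"
          unfolding disjoint_family_on_def
        proof (intro ballI impI, rule ccontr)
          fix c c' assume c: "c \<in> C j" "c' \<in> C j" "c \<noteq> c'" and "P j c \<inter> P j c' \<noteq> {}"
          then have "\<forall>s\<in>S. c s = c' s" by (auto simp: P_def)
          with c show False unfolding C_def by (blast intro: PiE_ext)
        qed
      qed
      finally show "(\<Sum>c\<in>C j. \<bar>signed_of \<alpha> \<beta> (P j c)\<bar> * (\<Sum>s\<in>S. real (c s) / real (Suc j)) ^ n)
          \<le> lam_norm (count_space S) \<alpha> \<beta>" .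
    qed auto
    show "(\<lambda>j. T j w) \<longlonglongrightarrow> measure \<mu> {w}" if w: "w \<in> PiE {..<n} (\<lambda>_. S)" for w
    proof -
      have "{w} \<in> sets (powS n (count_space S))" using w S by (simp add: powS_count_space)
      then have "measure \<mu> {w} = (\<integral>\<nu>. measure (powS n \<nu>) {w} \<partial>\<alpha>) - (\<integral>\<nu>. measure (powS n \<nu>) {w} \<partial>\<beta>)"
        using rep unfolding represents_def by blast
      then show ?thesis unfolding T_def
        by (simp only:) (intro tendsto_diff lim fin sets w)
    qed
  qed simp
qed

subsection \<open>Exchangeable and extendible laws\<close>

lemma measurable_comp_permutes:
  assumes "\<sigma> permutes {..<n}"
  shows "(\<lambda>x. x \<circ> \<sigma>) \<in> powS n S \<rightarrow>\<^sub>M powS n S"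
proof -
  have "(\<lambda>x. \<lambda>i\<in>{..<n}. x (\<sigma> i)) \<in> powS n S \<rightarrow>\<^sub>M powS n S"
    using permutes_in_image[OF assms] by (intro measurable_restrict measurable_component_singleton) auto
  moreover have "x \<circ> \<sigma> = (\<lambda>i\<in>{..<n}. x (\<sigma> i))" if "x \<in> space (powS n S)" for x
    using that permutes_not_in[OF assms] by (auto simp: space_PiM PiE_iff extensional_def fun_eq_iff)
  ultimately show ?thesis by (subst measurable_cong)
qed

lemma measurable_restrict_powS:
  "n \<le> N \<Longrightarrow> (\<lambda>x. restrict x {..<n}) \<in> powS N S \<rightarrow>\<^sub>M powS n S"
  by (rule measurable_restrict_subset) auto

lemma exchangeable_sets:
  "exchangeable N S \<mu> \<Longrightarrow> sets \<mu> = sets (powS N S)"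
  "exchangeable N S \<mu> \<Longrightarrow> space \<mu> = space (powS N S)"
  by (auto simp: exchangeable_def space_prob_algebra dest: sets_eq_imp_space_eq)

lemma exchangeable_prob_space: "exchangeable N S \<mu> \<Longrightarrow> prob_space \<mu>"
  by (auto simp: exchangeable_def space_prob_algebra)

lemma exchangeable_restrict:
  assumes ex: "exchangeable N S \<mu>" and n: "n \<le> N"
  shows "exchangeable n S (distr \<mu> (powS n S) (\<lambda>x. restrict x {..<n}))" (is "exchangeable n S ?D")
proof -
  interpret prob_space \<mu> by (rule exchangeable_prob_space[OF ex])
  have r: "(\<lambda>x. restrict x {..<n}) \<in> \<mu> \<rightarrow>\<^sub>M powS n S"
    using measurable_restrict_powS[OF n] by (simp add: measurable_cong_sets[OF exchangeable_sets(1)[OF ex]])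
  have "distr ?D (powS n S) (\<lambda>x. x \<circ> \<sigma>) = ?D" if \<sigma>: "\<sigma> permutes {..<n}" for \<sigma>
  proof -
    \<comment> \<open>A permutation of the first n indices fixes all others, so it also acts on the
      longer vector and commutes with truncation.\<close>
    have \<sigma>N: "\<sigma> permutes {..<N}" using \<sigma> n by (auto intro: permutes_subset)
    have c: "(\<lambda>x. x \<circ> \<sigma>) \<in> \<mu> \<rightarrow>\<^sub>M powS N S"
      using measurable_comp_permutes[OF \<sigma>N] by (simp add: measurable_cong_sets[OF exchangeable_sets(1)[OF ex]])
    have "distr ?D (powS n S) (\<lambda>x. x \<circ> \<sigma>) = distr \<mu> (powS n S) ((\<lambda>x. x \<circ> \<sigma>) \<circ> (\<lambda>x. restrict x {..<n}))"
      by (rule distr_distr[OF measurable_comp_permutes[OF \<sigma>] r])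
    also have "\<dots> = distr \<mu> (powS n S) ((\<lambda>x. restrict x {..<n}) \<circ> (\<lambda>x. x \<circ> \<sigma>))"
      using permutes_in_image[OF \<sigma>] by (intro distr_cong refl) (auto simp: fun_eq_iff)
    also have "\<dots> = distr (distr \<mu> (powS N S) (\<lambda>x. x \<circ> \<sigma>)) (powS n S) (\<lambda>x. restrict x {..<n})"
      by (rule distr_distr[OF measurable_restrict_powS[OF n] c, symmetric])
    also have "distr \<mu> (powS N S) (\<lambda>x. x \<circ> \<sigma>) = \<mu>" using ex \<sigma>N by (auto simp: exchangeable_def)
    finally show ?thesis .
  qed
  then show ?thesis
    using prob_space_distr[OF r] by (auto simp: exchangeable_def space_prob_algebra)
qed

text \<open>Exchangeability in the form used below: any n distinct coordinates, listed by a
  permutation, have the law of the first n.\<close>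

lemma measure_restrict_permute:
  assumes ex: "exchangeable N S \<mu>" and n: "n \<le> N" and A: "A \<in> sets (powS n S)" and p: "p permutes {..<N}"
  shows "measure (distr \<mu> (powS n S) (\<lambda>x. restrict x {..<n})) A
    = measure \<mu> {x \<in> space \<mu>. (\<lambda>i\<in>{..<n}. x (p i)) \<in> A}"
proof -
  note cong = measurable_cong_sets[OF exchangeable_sets(1)[OF ex] refl]
  have c: "(\<lambda>x. x \<circ> p) \<in> \<mu> \<rightarrow>\<^sub>M powS N S"
    using measurable_comp_permutes[OF p] by (simp add: cong)
  have "distr \<mu> (powS N S) (\<lambda>x. x \<circ> p) = \<mu>" using ex p by (auto simp: exchangeable_def)
  then have "distr \<mu> (powS n S) (\<lambda>x. restrict x {..<n})
      = distr (distr \<mu> (powS N S) (\<lambda>x. x \<circ> p)) (powS n S) (\<lambda>x. restrict x {..<n})" by simp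
  also have "\<dots> = distr \<mu> (powS n S) ((\<lambda>x. restrict x {..<n}) \<circ> (\<lambda>x. x \<circ> p))"
    by (rule distr_distr[OF measurable_restrict_powS[OF n] c])
  also have "measure \<dots> A = measure \<mu> (((\<lambda>x. restrict x {..<n}) \<circ> (\<lambda>x. x \<circ> p)) -` A \<inter> space \<mu>)"
    by (rule measure_distr[OF measurable_comp[OF c measurable_restrict_powS[OF n]] A])
  also have "((\<lambda>x. restrict x {..<n}) \<circ> (\<lambda>x. x \<circ> p)) -` A \<inter> space \<mu>
      = {x \<in> space \<mu>. (\<lambda>i\<in>{..<n}. x (p i)) \<in> A}"
    by (auto simp: comp_def)
  finally show ?thesis .
qed

lemma permutes_less_iff: "p permutes {..<N} \<Longrightarrow> p i < N \<longleftrightarrow> i < (N::nat)"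
  using permutes_in_image[of p "{..<N}" i] by simp

lemma sum_mu_draw_id:
  assumes "n \<le> N"
  shows "(\<Sum>w\<in>PiE {..<n} (\<lambda>_. {..<N}). mu_draw n N (\<lambda>i. i) w * h w)
    = (\<Sum>p | p permutes {..<N}. h (restrict p {..<n})) / fact N"
proof -
  define W where "W = PiE {..<n} (\<lambda>_. {..<N})"
  have finW: "finite W" unfolding W_def by (auto intro: finite_PiE)
  have "(\<Sum>w\<in>W. mu_draw n N (\<lambda>i. i) w * h w)
      = (\<Sum>w\<in>W. \<Sum>p | p permutes {..<N}. of_bool (\<forall>i<n. p i = w i) * h w) / fact N"
    by (simp add: mu_draw_eq_sum sum_divide_distrib sum_distrib_right)
  also have "\<dots> = (\<Sum>p | p permutes {..<N}. \<Sum>w\<in>W. of_bool (\<forall>i<n. p i = w i) * h w) / fact N"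
    by (subst sum.swap) simp
  also have "\<dots> = (\<Sum>p | p permutes {..<N}. h (restrict p {..<n})) / fact N"
  proof (intro arg_cong2[of _ _ _ _ "(/)"] sum.cong refl)
    fix p assume "p \<in> {p. p permutes {..<N}}"
    then have p: "restrict p {..<n} \<in> W" using assms by (auto simp: W_def permutes_less_iff)
    have "(\<Sum>w\<in>W. of_bool (\<forall>i<n. p i = w i) * h w) = (\<Sum>w\<in>W. if w = restrict p {..<n} then h w else 0)"
      by (intro sum.cong refl) (auto simp: W_def of_bool_def fun_eq_iff PiE_iff extensional_def)
    also have "\<dots> = h (restrict p {..<n})" using p finW by (subst sum.delta) auto
    finally show "(\<Sum>w\<in>W. of_bool (\<forall>i<n. p i = w i) * h w) = h (restrict p {..<n})" .
  qed
  finally show ?thesis by (simp add: W_def)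
qed

lemma card_permutes: "card {p. p permutes {..<N::nat}} = fact N"
  by (rule card_permutations) auto

lemma exchangeable_ex_represents:
  assumes n: "1 \<le> n" "n \<le> N" and ext: "extendible n N S \<mu>"
  shows "\<exists>\<alpha> \<beta>. represents n S \<mu> \<alpha> \<beta> \<and> lam_norm S \<alpha> \<beta> \<le> kappa n N"
proof -
  obtain \<mu>' where ex: "exchangeable N S \<mu>'" and \<mu>: "\<mu> = distr \<mu>' (powS n S) (\<lambda>x. restrict x {..<n})"
    using ext by (auto simp: extendible_def)
  show ?thesis
  \<comment> \<open>The sample space carries the extending law and the random points are its
    coordinates. The draw tensor averages over permutations, and every term of that average equals
    \<open>measure \<mu> A\<close>.\<close>
  proof (rule represents_of_pos_rep[OF exchangeable_prob_space[OF ex], of "{..<N}" n "mu_draw n N (\<lambda>i. i)" _ "\<lambda>j x. x j"])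
    show "pos_rep {..<N} n (mu_draw n N (\<lambda>i. i)) (kappa n N)" using n by (intro pos_rep_kappa) auto
    show "(\<lambda>x. x j) \<in> \<mu>' \<rightarrow>\<^sub>M S" if "j \<in> {..<N}" for j
      unfolding measurable_cong_sets[OF exchangeable_sets(1)[OF ex] refl]
      by (rule measurable_component_singleton[OF that])
    fix A assume A: "A \<in> sets (powS n S)"
    show "measure \<mu> A = (\<Sum>w\<in>{..<n} \<rightarrow>\<^sub>E {..<N}. mu_draw n N (\<lambda>i. i) w *
        measure \<mu>' {x \<in> space \<mu>'. (\<lambda>i\<in>{..<n}. x (w i)) \<in> A})"
    proof -
      have "measure \<mu>' {x \<in> space \<mu>'. (\<lambda>i\<in>{..<n}. x (restrict p {..<n} i)) \<in> A} = measure \<mu> A"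
        if "p permutes {..<N}" for p
        unfolding \<mu> measure_restrict_permute[OF ex n(2) A that] by (simp cong: restrict_cong)
      then show ?thesis
        unfolding sum_mu_draw_id[OF n(2)] by (simp add: card_permutes)
    qed
  qed (use n in \<open>auto simp: lessThan_empty_iff\<close>)
qed

lemma finite_exchangeable_ex_represents:
  assumes n: "1 \<le> n" "n \<le> N" and S: "finite S" "S \<noteq> {}" and ext: "extendible n N (count_space S) \<mu>"
  shows "\<exists>\<alpha> \<beta>. represents n (count_space S) \<mu> \<alpha> \<beta> \<and> lam_norm (count_space S) \<alpha> \<beta> \<le> kappa_m n N S"
proof -
  obtain \<mu>' where ex: "exchangeable N (count_space S) \<mu>'"
    and \<mu>: "\<mu> = distr \<mu>' (powS n (count_space S)) (\<lambda>x. restrict x {..<n})"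
    using ext by (auto simp: extendible_def)
  interpret \<mu>': prob_space \<mu>' by (rule exchangeable_prob_space[OF ex])
  have exn: "exchangeable n (count_space S) \<mu>" unfolding \<mu> by (rule exchangeable_restrict[OF ex n(2)])
  interpret \<mu>: prob_space \<mu> by (rule exchangeable_prob_space[OF exn])
  define V where "V = PiE {..<N} (\<lambda>_. S)"
  define W where "W = PiE {..<n} (\<lambda>_. S)"
  have fin: "finite V" "finite W" using S by (auto simp: V_def W_def intro: finite_PiE)
  have sV: "sets \<mu>' = Pow V" "space \<mu>' = V"
    using exchangeable_sets[OF ex] S by (auto simp: powS_count_space V_def)
  have sW: "sets \<mu> = Pow W" "space \<mu> = W"
    using exchangeable_sets[OF exn] S by (auto simp: powS_count_space W_def)
  \<comment> \<open>Averaging the identity \<open>*\<close> over all \<open>p\<close> turns the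
    indicators into draw probabilities: given the N values in order, the first n behave on average
    like draws without replacement.\<close>
  have \<mu>w: "measure \<mu> {w} = (\<Sum>x\<in>V. measure \<mu>' {x} * mu_draw n N x w)" if w: "w \<in> W" for w
  proof -
    have *: "measure \<mu> {w} = (\<Sum>x\<in>V. measure \<mu>' {x} * of_bool (\<forall>i<n. x (p i) = w i))"
      if p: "p permutes {..<N}" for p
    proof -
      have "measure \<mu> {w} = measure \<mu>' {x \<in> space \<mu>'. (\<lambda>i\<in>{..<n}. x (p i)) \<in> {w}}"
        unfolding \<mu> using w S by (intro measure_restrict_permute[OF ex n(2) _ p]) (simp add: powS_count_space W_def)
      also have "{x \<in> space \<mu>'. (\<lambda>i\<in>{..<n}. x (p i)) \<in> {w}} = {x \<in> V. \<forall>i<n. x (p i) = w i}"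
        using w by (auto simp: sV W_def PiE_iff extensional_def fun_eq_iff)
      also have "measure \<mu>' \<dots> = (\<Sum>x\<in>{x \<in> V. \<forall>i<n. x (p i) = w i}. measure \<mu>' {x})"
        using fin by (intro \<mu>'.finite_measure_eq_sum_singleton) (auto simp: sV)
      also have "\<dots> = (\<Sum>x\<in>V. measure \<mu>' {x} * of_bool (\<forall>i<n. x (p i) = w i))"
        using fin by (intro sum.mono_neutral_cong_left) auto
      finally show ?thesis .
    qed
    have "measure \<mu> {w} = (\<Sum>p | p permutes {..<N}. measure \<mu> {w}) / fact N"
      by (simp add: card_permutes)
    also have "\<dots> = (\<Sum>p | p permutes {..<N}. \<Sum>x\<in>V. measure \<mu>' {x} * of_bool (\<forall>i<n. x (p i) = w i)) / fact N"
      using * by simp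
    also have "\<dots> = (\<Sum>x\<in>V. measure \<mu>' {x} * mu_draw n N x w)"
      by (subst sum.swap) (simp add: mu_draw_eq_sum sum_divide_distrib sum_distrib_left)
    finally show ?thesis .
  qed
  have "pos_rep S n (\<lambda>w. \<Sum>x\<in>V. measure \<mu>' {x} * mu_draw n N x w) (\<Sum>x\<in>V. \<bar>measure \<mu>' {x}\<bar> * kappa_m n N S)"
    using fin n S by (intro pos_rep_sum pos_rep_kappa_m) (auto simp: V_def)
  \<comment> \<open>The weights form a probability vector, so mixing the draw tensors does not raise
    the bound.\<close>
  also have "(\<Sum>x\<in>V. \<bar>measure \<mu>' {x}\<bar> * kappa_m n N S) = kappa_m n N S"
  proof -
    have "(\<Sum>x\<in>V. measure \<mu>' {x}) = measure \<mu>' V"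
      using fin sV by (intro \<mu>'.finite_measure_eq_sum_singleton[symmetric]) auto
    then show ?thesis using \<mu>'.prob_space by (simp add: sV sum_distrib_right[symmetric])
  qed
  finally have rep: "pos_rep S n (\<lambda>w. measure \<mu> {w}) (kappa_m n N S)"
    by (rule pos_rep_cong) (simp add: \<mu>w W_def)
  show ?thesis
  \<comment> \<open>The points are deterministic here, \<open>X j = j\<close>, so the event in the
    formula is everything or empty according to whether the word lies in \<open>A\<close>;
    \<open>\<mu>\<close> merely serves as some probability space.\<close>
  proof (rule represents_of_pos_rep[OF \<mu>.prob_space_axioms S n(1) rep, of "\<lambda>j _. j"])
    fix A assume "A \<in> sets (powS n (count_space S))"
    then have A: "A \<subseteq> W" using S by (simp add: powS_count_space W_def)
    have "measure \<mu> A = (\<Sum>w\<in>A. measure \<mu> {w})"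
      using A fin finite_subset by (intro \<mu>.finite_measure_eq_sum_singleton) (auto simp: sW)
    also have "\<dots> = (\<Sum>w\<in>W. measure \<mu> {w} * measure \<mu> {\<omega> \<in> space \<mu>. (\<lambda>i\<in>{..<n}. w i) \<in> A})"
    proof (rule sum.mono_neutral_cong_left[OF fin(2) A])
      have w: "(\<lambda>i\<in>{..<n}. w i) = w" if "w \<in> W" for w using that by (auto simp: W_def)
      show "\<forall>w\<in>W - A. measure \<mu> {w} * measure \<mu> {\<omega> \<in> space \<mu>. (\<lambda>i\<in>{..<n}. w i) \<in> A} = 0"
        using w by auto
      show "measure \<mu> {v} = measure \<mu> {v} * measure \<mu> {\<omega> \<in> space \<mu>. (\<lambda>i\<in>{..<n}. v i) \<in> A}"
        if "v \<in> A" for v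
        using that A w[of v] \<mu>.prob_space by auto
    qed
    finally show "measure \<mu> A = (\<Sum>w\<in>{..<n} \<rightarrow>\<^sub>E S. measure \<mu> {w} *
        measure \<mu> {\<omega> \<in> space \<mu>. (\<lambda>i\<in>{..<n}. w i) \<in> A})" by (simp only: W_def)
  qed auto
qed

section \<open>Uniformly shuffled vectors as extremal examples\<close>

definition draws :: "nat \<Rightarrow> 'a measure \<Rightarrow> (nat \<Rightarrow> 'a) \<Rightarrow> (nat \<Rightarrow> 'a) measure" where
  "draws N S x = weighted_diracs {p. p permutes {..<N}} (\<lambda>_. 1 / fact N) (\<lambda>p. \<lambda>i\<in>{..<N}. x (p i)) (powS N S)"

lemma sets_draws [simp, measurable_cong]: "sets (draws N S x) = sets (powS N S)"
  by (simp add: draws_def)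

lemma draws_funcset:
  assumes "x \<in> {..<N} \<rightarrow> space S"
  shows "(\<lambda>p. \<lambda>i\<in>{..<N}. x (p i)) \<in> {p. p permutes {..<N}} \<rightarrow> space (powS N S)"
  using assms by (auto simp: space_PiM permutes_less_iff Pi_iff)

lemma exchangeable_draws:
  assumes x: "x \<in> {..<N} \<rightarrow> space S"
  shows "exchangeable N S (draws N S x)"
  unfolding exchangeable_def
proof (intro conjI allI impI)
  have "prob_space (draws N S x)" unfolding draws_def
    by (rule prob_space_weighted_diracs[OF finite_permutations draws_funcset[OF x]]) (auto simp: card_permutes)
  then show "draws N S x \<in> space (prob_algebra (powS N S))"
    by (simp add: space_prob_algebra draws_def)
  fix \<sigma> assume \<sigma>: "\<sigma> permutes {..<N}"
  have c: "(\<lambda>y. y \<circ> \<sigma>) \<in> draws N S x \<rightarrow>\<^sub>M powS N S"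
    unfolding measurable_cong_sets[OF sets_draws refl]
    by (rule measurable_comp_permutes[OF \<sigma>])
  show "distr (draws N S x) (powS N S) (\<lambda>y. y \<circ> \<sigma>) = draws N S x"
  proof (rule measure_eqI)
    fix A assume "A \<in> sets (distr (draws N S x) (powS N S) (\<lambda>y. y \<circ> \<sigma>))"
    then have A: "A \<in> sets (powS N S)" by simp
    define h where "h p = ennreal (1 / fact N) * indicator A (\<lambda>i\<in>{..<N}. x (p i))" for p
    have sp: "space (draws N S x) = space (powS N S)" by (simp add: draws_def)
    define B where "B = (\<lambda>y. y \<circ> \<sigma>) -` A \<inter> space (draws N S x)"
    have B: "B \<in> sets (powS N S)"
      using measurable_sets[OF measurable_comp_permutes[OF \<sigma>] A] by (simp add: sp B_def)
    have "emeasure (distr (draws N S x) (powS N S) (\<lambda>y. y \<circ> \<sigma>)) A = emeasure (draws N S x) B"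
      unfolding B_def by (rule emeasure_distr[OF c A])
    also have "\<dots> = (\<Sum>p | p permutes {..<N}. ennreal (1 / fact N) * indicator B (\<lambda>i\<in>{..<N}. x (p i)))"
      unfolding draws_def by (intro emeasure_weighted_diracs finite_permutations draws_funcset[OF x] B) auto
    also have "\<dots> = (\<Sum>p | p permutes {..<N}. h (p \<circ> \<sigma>))"
    proof (intro sum.cong refl)
      fix p assume p: "p \<in> {p. p permutes {..<N}}"
      have "(\<lambda>i\<in>{..<N}. x (p i)) \<circ> \<sigma> = (\<lambda>i\<in>{..<N}. x ((p \<circ> \<sigma>) i))"
        using permutes_in_image[OF \<sigma>] by (auto simp: fun_eq_iff)
      moreover have "(\<lambda>i\<in>{..<N}. x (p i)) \<in> space (draws N S x)"
        using draws_funcset[OF x] p unfolding sp by (rule funcset_mem)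
      ultimately show "ennreal (1 / fact N) * indicator B (\<lambda>i\<in>{..<N}. x (p i)) = h (p \<circ> \<sigma>)"
        by (simp add: h_def B_def indicator_def)
    qed
    \<comment> \<open>Composition with \<open>\<sigma>\<close> permutes the symmetric group, and all
      weights are equal.\<close>
    also have "\<dots> = (\<Sum>p | p permutes {..<N}. h p)"
      by (rule sum_permutations_compose_right[OF \<sigma>, symmetric])
    also have "\<dots> = emeasure (draws N S x) A"
      unfolding draws_def h_def
      by (intro emeasure_weighted_diracs[symmetric] finite_permutations draws_funcset[OF x] A) auto
    finally show "emeasure (distr (draws N S x) (powS N S) (\<lambda>y. y \<circ> \<sigma>)) A = emeasure (draws N S x) A" .
  qed (simp add: draws_def)
qed

lemma ex_extendible_mu_draw:
  assumes n: "n \<le> N" and S: "finite S" and x: "x \<in> {..<N} \<rightarrow> S"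
  shows "\<exists>\<mu>. exchangeable n (count_space S) \<mu> \<and> extendible n N (count_space S) \<mu> \<and>
    (\<forall>w\<in>PiE {..<n} (\<lambda>_. S). measure \<mu> {w} = mu_draw n N x w)"
proof (intro exI conjI ballI)
  have x': "x \<in> {..<N} \<rightarrow> space (count_space S)" using x by simp
  define \<mu>' where "\<mu>' = draws N (count_space S) x"
  have ex: "exchangeable N (count_space S) \<mu>'"
    unfolding \<mu>'_def by (rule exchangeable_draws[OF x'])
  let ?\<mu> = "distr \<mu>' (powS n (count_space S)) (\<lambda>x. restrict x {..<n})"
  show "exchangeable n (count_space S) ?\<mu>" by (rule exchangeable_restrict[OF ex n])
  show "extendible n N (count_space S) ?\<mu>" using ex by (auto simp: extendible_def)
  fix w assume w: "w \<in> PiE {..<n} (\<lambda>_. S)"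
  \<comment> \<open>The identity permutation is written out so that the formula for permuted
    coordinates applies.\<close>
  define E where "E = {y \<in> space \<mu>'. (\<lambda>i\<in>{..<n}. y (id i)) \<in> {w}}"
  have "measure ?\<mu> {w} = measure \<mu>' E"
    unfolding E_def using w S by (intro measure_restrict_permute[OF ex n _ permutes_id]) (simp add: powS_count_space)
  also have "\<dots> = (\<Sum>p | p permutes {..<N}. 1 / fact N * indicator E (\<lambda>i\<in>{..<N}. x (p i)))"
    unfolding \<mu>'_def draws_def
  proof (intro measure_weighted_diracs finite_permutations draws_funcset[OF x'])
    show "E \<in> sets (powS N (count_space S))"
      using S exchangeable_sets(2)[OF ex] by (auto simp: powS_count_space E_def)
  qed auto
  also have "\<dots> = (\<Sum>p | p permutes {..<N}. of_bool (\<forall>i<n. x (p i) = w i) / fact N)"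
  proof (intro sum.cong refl)
    fix p assume p: "p \<in> {p. p permutes {..<N}}"
    have "(\<lambda>i\<in>{..<N}. x (p i)) \<in> space \<mu>'"
      using draws_funcset[OF x'] p unfolding exchangeable_sets(2)[OF ex] by (rule funcset_mem)
    then have "(\<lambda>i\<in>{..<N}. x (p i)) \<in> E \<longleftrightarrow> (\<forall>i<n. x (p i) = w i)"
      using n w by (auto simp: E_def fun_eq_iff PiE_iff extensional_def)
    then show "1 / fact N * indicator E (\<lambda>i\<in>{..<N}. x (p i)) = of_bool (\<forall>i<n. x (p i) = w i) / (fact N :: real)"
      by (simp add: indicator_def)
  qed
  also have "\<dots> = mu_draw n N x w" by (simp add: mu_draw_eq_sum sum_divide_distrib)
  finally show "measure ?\<mu> {w} = mu_draw n N x w" .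
qed

section \<open>Assembly of the upper bounds and their sharpness\<close>

theorem theorem7p10:
  fixes n N :: nat and S :: "'a measure" and S0 :: "'b set"
  assumes "1 \<le> n" and "n \<le> N"
  shows
    \<comment> \<open>(i) representation with norm at most kappa(n,N), for arbitrary S\<close>
    "(\<forall>\<mu>. exchangeable n S \<mu> \<and> extendible n N S \<mu> \<longrightarrow>
        (\<exists>\<alpha> \<beta>. represents n S \<mu> \<alpha> \<beta> \<and> lam_norm S \<alpha> \<beta> \<le> kappa n N))
   \<and> \<comment> \<open>(i) sharpness: some S and mu for which every representation has norm >= kappa(n,N)\<close>
    (\<exists>(T :: nat measure) \<mu>. exchangeable n T \<mu> \<and> extendible n N T \<mu> \<and>
        (\<forall>\<alpha> \<beta>. represents n T \<mu> \<alpha> \<beta> \<longrightarrow> kappa n N \<le> lam_norm T \<alpha> \<beta>))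
   \<and> \<comment> \<open>(ii) S finite (discrete) with |S| = m\<close>
    (finite S0 \<and> S0 \<noteq> {} \<longrightarrow>
      (\<forall>\<mu>. exchangeable n (count_space S0) \<mu> \<and> extendible n N (count_space S0) \<mu> \<longrightarrow>
         (\<exists>\<alpha> \<beta>. represents n (count_space S0) \<mu> \<alpha> \<beta> \<and>
                 lam_norm (count_space S0) \<alpha> \<beta> \<le> kappa_m n N S0))
    \<and> (\<forall>M::real. (\<forall>\<mu>. exchangeable n (count_space S0) \<mu> \<and> extendible n N (count_space S0) \<mu> \<longrightarrow>
         (\<exists>\<alpha> \<beta>. represents n (count_space S0) \<mu> \<alpha> \<beta> \<and>
                 lam_norm (count_space S0) \<alpha> \<beta> \<le> M)) \<longrightarrow> kappa_m n N S0 \<le> M)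
    \<and> (card S0 \<ge> N \<longrightarrow> kappa_m n N S0 = kappa n N))"
proof (intro conjI impI allI)
  fix \<mu> assume "exchangeable n S \<mu> \<and> extendible n N S \<mu>"
  then show "\<exists>\<alpha> \<beta>. represents n S \<mu> \<alpha> \<beta> \<and> lam_norm S \<alpha> \<beta> \<le> kappa n N"
    by (intro exchangeable_ex_represents[OF assms]) auto
next
  \<comment> \<open>The extremal example is drawing from N distinct points: every signed mixture
    representing it yields a decomposition of the draw tensor at no greater cost.\<close>
  obtain \<mu> where \<mu>: "exchangeable n (count_space {..<N}) \<mu>" "extendible n N (count_space {..<N}) \<mu>"
    "\<forall>w\<in>PiE {..<n} (\<lambda>_. {..<N}). measure \<mu> {w} = mu_draw n N (\<lambda>i. i) w"
    using ex_extendible_mu_draw[OF assms(2), of "{..<N}" "\<lambda>i. i"] by auto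
  have "kappa n N \<le> lam_norm (count_space {..<N}) \<alpha> \<beta>"
    if "represents n (count_space {..<N}) \<mu> \<alpha> \<beta>" for \<alpha> \<beta>
  proof (rule kappa_le[OF assms(2), of "{..<N}" "\<lambda>i. i"])
    have "pos_rep {..<N} n (\<lambda>w. measure \<mu> {w}) (lam_norm (count_space {..<N}) \<alpha> \<beta>)"
      using assms that by (intro pos_rep_of_represents) (auto simp: lessThan_empty_iff)
    then show "pos_rep {..<N} n (mu_draw n N (\<lambda>i. i)) (lam_norm (count_space {..<N}) \<alpha> \<beta>)"
      by (rule pos_rep_cong) (use \<mu>(3) in simp)
  qed auto
  then show "\<exists>(T :: nat measure) \<mu>. exchangeable n T \<mu> \<and> extendible n N T \<mu> \<and>
        (\<forall>\<alpha> \<beta>. represents n T \<mu> \<alpha> \<beta> \<longrightarrow> kappa n N \<le> lam_norm T \<alpha> \<beta>)"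
    using \<mu> by blast
next
  fix \<mu> assume "finite S0 \<and> S0 \<noteq> {}"
    "exchangeable n (count_space S0) \<mu> \<and> extendible n N (count_space S0) \<mu>"
  then show "\<exists>\<alpha> \<beta>. represents n (count_space S0) \<mu> \<alpha> \<beta> \<and>
      lam_norm (count_space S0) \<alpha> \<beta> \<le> kappa_m n N S0"
    by (intro finite_exchangeable_ex_represents[OF assms]) auto
next
  fix M :: real
  assume S0: "finite S0 \<and> S0 \<noteq> {}"
    and M: "\<forall>\<mu>. exchangeable n (count_space S0) \<mu> \<and> extendible n N (count_space S0) \<mu> \<longrightarrow>
         (\<exists>\<alpha> \<beta>. represents n (count_space S0) \<mu> \<alpha> \<beta> \<and> lam_norm (count_space S0) \<alpha> \<beta> \<le> M)"
  \<comment> \<open>Each draw law is itself exchangeable and extendible, so \<open>M\<close> must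
    bound its norm, and hence the maximum over all \<open>x\<close>.\<close>
  have "pis_norm S0 n (mu_draw n N x) \<le> M" if x: "x \<in> PiE {..<N} (\<lambda>_. S0)" for x
  proof -
    obtain \<mu> where \<mu>: "exchangeable n (count_space S0) \<mu>" "extendible n N (count_space S0) \<mu>"
      "\<forall>w\<in>PiE {..<n} (\<lambda>_. S0). measure \<mu> {w} = mu_draw n N x w"
      using ex_extendible_mu_draw[OF assms(2), of S0 x] S0 x by (auto simp: PiE_def)
    obtain \<alpha> \<beta> where rep: "represents n (count_space S0) \<mu> \<alpha> \<beta>"
      and le: "lam_norm (count_space S0) \<alpha> \<beta> \<le> M"
      using M \<mu>(1,2) by blast
    have "pos_rep S0 n (\<lambda>w. measure \<mu> {w}) M"
      using pos_rep_of_represents[OF _ _ assms(1) rep] S0 le by (auto intro: pos_rep_mono)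
    then have "pos_rep S0 n (mu_draw n N x) M" by (rule pos_rep_cong) (use \<mu>(3) in simp)
    then show ?thesis using S0 by (intro pis_norm_le) auto
  qed
  then show "kappa_m n N S0 \<le> M" using S0 by (subst kappa_m_le_iff) auto
next
  assume "finite S0 \<and> S0 \<noteq> {}" "N \<le> card S0"
  then show "kappa_m n N S0 = kappa n N" by (intro kappa_m_eq_kappa[OF assms]) auto
qed

end
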